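(* Let $d\ge 2$, $\alpha\in(0,2)$, $m>0$, and let $D\subset\mathbb{R}^d$ be a domain of finite volume $|D|<\infty$ (in particular, any bounded domain). Then $$\lim_{t\to 0^+} t^{d/\alpha}e^{-mt}Z_D(t)=C_1|D|,\qquad C_1=\frac{\omega_d\,\Gamma(d/\alpha)}{(2\pi)^d\alpha},$$ where $Z_D(t)=\int_D p_D(t,x,x)\,dx$ is the trace of the heat semigroup of the relativistic $\alpha$-stable process with mass $m$ killed upon exiting $D$, and $\omega_d=\frac{2\pi^{d/2}}{\Gamma(d/2)}$.
   Context: The relativistic $\alpha$-stable process with mass $m$ is the $\mathbb{R}^d$-valued process $X_t$ with stationary independent increments, right-continuous sample paths with left limits, and (started at $0$) characteristic function $\mathbb{E}e^{i\xi\cdot X_t}=e^{-t\{(m^{2/\alpha}+|\xi|^2)^{\alpha/2}-m\}}$, $\xi\in\mathbb{R}^d$. $\mathbb{E}^x$ denotes expectation for the process started at $x$. Its transition density is $p(t,x,y)=p(t,x-y)$, where, with $\beta=\alpha/2$, $$p(t,x)=e^{mt}\int_0^\infty \frac{1}{(4\pi u)^{d/2}}e^{-|x|^2/(4u)}e^{-m^{1/\beta}u}\theta_\beta(t,u)\,du,$$ and $\theta_\beta(t,\cdot)$ is the density of the strictly $\beta$-stable subordinator $T_\beta(t)$ with $\mathbb{E}e^{-\lambda T_\beta(t)}=e^{-t\lambda^\beta}$, $\lambda>0$. For an open set $D$, $\tau_D=\inf\{t\ge0: X_t\notin D\}$, $r_D(t,x,y)=\mathbb{E}^x[p(t-\tau_D,X_{\tau_D},y);\,\tau_D<t]$,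 and $p_D(t,x,y)=p(t,x,y)-r_D(t,x,y)$. $|D|$ is the $d$-dimensional Lebesgue measure of $D$. *)

theory Defs
  imports "HOL-Probability.Probability"
begin

definition cadlag :: "(real \<Rightarrow> 'a::topological_space) \<Rightarrow> bool" where
  "cadlag f \<longleftrightarrow>
     (\<forall>t\<ge>0. (f \<longlongrightarrow> f t) (at_right t)) \<and> (\<forall>t>0. \<exists>l. (f \<longlongrightarrow> l) (at_left t))"

text \<open>Time is the half-line of nonnegative reals; values \<open>X t\<close> with \<open>t < 0\<close> are irrelevant.
  The process started at \<open>x\<close> is \<open>x + X t\<close>.\<close>

locale levy_process = prob_space M for M :: "'w measure" +
  fixes X :: "real \<Rightarrow> 'w \<Rightarrow> 'a::euclidean_space"
  assumes random_variable_X: "0 \<le> t \<Longrightarrow> random_variable borel (X t)"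
    and start_at_zero: "AE \<omega> in M. X 0 \<omega> = 0"
    and cadlag_paths: "AE \<omega> in M. cadlag (\<lambda>t. X t \<omega>)"
    and independent_increments:
      "\<And>(s :: nat \<Rightarrow> real) n. 0 \<le> s 0 \<Longrightarrow> (\<And>i. i < n \<Longrightarrow> s i \<le> s (Suc i)) \<Longrightarrow>
         indep_vars (\<lambda>_. borel) (\<lambda>i \<omega>. X (s (Suc i)) \<omega> - X (s i) \<omega>) {..<n}"
    and stationary_increments:
      "0 \<le> s \<Longrightarrow> 0 \<le> t \<Longrightarrow>
         distr M borel (\<lambda>\<omega>. X (s + t) \<omega> - X s \<omega>) = distr M borel (X t)"

locale relativistic_stable_process = levy_process M X
  for M :: "'w measure" and X :: "real \<Rightarrow> 'w \<Rightarrow> 'a::euclidean_space" +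
  fixes \<alpha> m :: real
  assumes characteristic_function:
    "0 \<le> t \<Longrightarrow> expectation (\<lambda>\<omega>. iexp (\<xi> \<bullet> X t \<omega>)) =
       complex_of_real (exp (- t * ((m powr (2 / \<alpha>) + (norm \<xi>)\<^sup>2) powr (\<alpha> / 2) - m)))"

locale stable_subordinator = levy_process N T
  for N :: "'v measure" and T :: "real \<Rightarrow> 'v \<Rightarrow> real" +
  fixes \<beta> :: real
  assumes nondecreasing_paths: "AE \<omega> in N. mono_on {0..} (\<lambda>t. T t \<omega>)"
    and laplace_transform:
      "0 \<le> t \<Longrightarrow> 0 < l \<Longrightarrow> expectation (\<lambda>\<omega>. exp (- l * T t \<omega>)) = exp (- t * l powr \<beta>)"

text \<open>In the following, \<open>\<theta> t\<close> stands for the density of the \<open>\<alpha> / 2\<close>-stable subordinator at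
  time \<open>t\<close>, and \<open>p\<^sub>D(t, x, y)\<close> etc. are only meaningful for \<open>t > 0\<close>.\<close>

definition rel_kernel ::
    "real \<Rightarrow> real \<Rightarrow> (real \<Rightarrow> real \<Rightarrow> real) \<Rightarrow> real \<Rightarrow> 'a::euclidean_space \<Rightarrow> real" where
  "rel_kernel \<alpha> m \<theta> t x = (let \<beta> = \<alpha> / 2 in
     exp (m * t) *
     (LINT u:{0<..}|lborel.
        1 / (4 * pi * u) powr (real DIM('a) / 2) * exp (- (norm x)\<^sup>2 / (4 * u)) *
        exp (- (m powr (1 / \<beta>)) * u) * \<theta> t u))"

text \<open>The exit time is \<open>\<infinity>\<close> if the path never leaves \<open>D\<close>.\<close>

definition exit_time :: "'a set \<Rightarrow> (real \<Rightarrow> 'a) \<Rightarrow> ereal" where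
  "exit_time D f = Inf {ereal t | t. 0 \<le> t \<and> f t \<notin> D}"

text \<open>The expectation is taken over the completion of \<open>M\<close>, since an exit time (the debut of a
  closed set) need only be measurable up to null sets, and the Bochner integral of a
  non-measurable function is 0 by convention.\<close>

definition killed_correction ::
    "'w measure \<Rightarrow> (real \<Rightarrow> 'w \<Rightarrow> 'a::euclidean_space) \<Rightarrow> real \<Rightarrow> real \<Rightarrow>
     (real \<Rightarrow> real \<Rightarrow> real) \<Rightarrow> 'a set \<Rightarrow> real \<Rightarrow> 'a \<Rightarrow> 'a \<Rightarrow> real" where
  "killed_correction M X \<alpha> m \<theta> D t x y =
     (let \<tau> = (\<lambda>\<omega>. exit_time D (\<lambda>s. x + X s \<omega>)) in
      LINT \<omega>:{\<omega> \<in> space M. \<tau> \<omega> < ereal t}|completion M.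
        rel_kernel \<alpha> m \<theta> (t - real_of_ereal (\<tau> \<omega>)) (x + X (real_of_ereal (\<tau> \<omega>)) \<omega> - y))"

definition killed_kernel ::
    "'w measure \<Rightarrow> (real \<Rightarrow> 'w \<Rightarrow> 'a::euclidean_space) \<Rightarrow> real \<Rightarrow> real \<Rightarrow>
     (real \<Rightarrow> real \<Rightarrow> real) \<Rightarrow> 'a set \<Rightarrow> real \<Rightarrow> 'a \<Rightarrow> 'a \<Rightarrow> real" where
  "killed_kernel M X \<alpha> m \<theta> D t x y =
     rel_kernel \<alpha> m \<theta> t (x - y) - killed_correction M X \<alpha> m \<theta> D t x y"

definition heat_trace ::
    "'w measure \<Rightarrow> (real \<Rightarrow> 'w \<Rightarrow> 'a::euclidean_space) \<Rightarrow> real \<Rightarrow> real \<Rightarrow>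
     (real \<Rightarrow> real \<Rightarrow> real) \<Rightarrow> 'a set \<Rightarrow> real \<Rightarrow> real" where
  "heat_trace M X \<alpha> m \<theta> D t = (LINT x:D|lebesgue. killed_kernel M X \<alpha> m \<theta> D t x x)"

definition sphere_area :: "nat \<Rightarrow> real" where
  "sphere_area d = 2 * pi powr (real d / 2) / Gamma (real d / 2)"

definition C1 :: "nat \<Rightarrow> real \<Rightarrow> real" where
  "C1 d \<alpha> = sphere_area d * Gamma (real d / \<alpha>) / ((2 * pi) ^ d * \<alpha>)"

end

theory Submission
  imports Defs
begin

text \<open>On the diagonal \<open>p\<^sub>D(t, x, x) = p(t, 0) - r\<^sub>D(t, x, x)\<close>, so the heat trace is \<open>p(t, 0) |D|\<close> minus the
integral over \<open>D\<close> of the killing correction \<open>r\<^sub>D(t, x, x)\<close>. The first term has the claimed limit and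
the second one is of smaller order.

For the first term write \<open>u\<close> to the power \<open>- d / 2\<close> as a Gamma integral over \<open>l\<close> and integrate the
density of the subordinator first. With \<open>c\<close> the power \<open>2 / \<alpha>\<close> of \<open>m\<close>, this turns \<open>e\<^sup>-\<^sup>m\<^sup>t p(t, 0)\<close> into
a multiple of the integral of \<open>l powr (d / 2 - 1) * exp (- t * (l + c) powr (\<alpha> / 2))\<close>. Since
\<open>l powr (\<alpha> / 2) \<le> (l + c) powr (\<alpha> / 2) \<le> l powr (\<alpha> / 2) + m\<close>, the integral lies between an explicit
Gamma integral and \<open>e\<^sup>-\<^sup>m\<^sup>t\<close> times it, which squeezes the scaled value to \<open>C1\<close> (\<open>rel_kernel_origin\<close>).

The second term goes to 0 by dominated convergence. Pointwise: a path from \<open>x\<close> exits \<open>D\<close> at a point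
whose distance to \<open>x\<close> is at least the distance \<open>\<rho>\<close> of \<open>x\<close> to the complement, and \<open>p(s, z)\<close> is bounded
for \<open>|z| \<ge> \<rho>\<close> uniformly in \<open>s\<close>, so the factor \<open>t powr (d / \<alpha>)\<close> wins (\<open>killed_correction_le_inside\<close>).
Domination: \<open>r\<^sub>D(t, x, x) \<le> p(t, 0)\<close> for almost every \<open>x\<close> (\<open>killed_correction_diagonal\<close>). This is optional
stopping for the nonnegative martingale \<open>p(t - s, X\<^sub>s)\<close>, \<open>s < t\<close>. The Fourier representation
\<open>rel_kernel_fourier\<close> reduces the martingale property to the characteristic function of the increments
(\<open>kernel_martingale_step\<close>). The process is stopped at the first time of a dyadic grid at which it lies in an open neighbourhood of the complement of \<open>D\<close>
(\<open>nn_integral_grid_stop_le\<close>); Fatou's lemma is then applied twice, first refining the grid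
(\<open>tendsto_grid_stop\<close>) and then shrinking the neighbourhood.

Shrinking the neighbourhood is the delicate step. The hitting times of the neighbourhoods increase to
a time that may be smaller than the exit time: this happens if the left limit of the path lies outside
\<open>D\<close> but the path jumps back into \<open>D\<close> at that very moment. For a fixed path this concerns only a null set
of starting points (\<open>AE_not_jumps_from_outside\<close>): there are countably many jump times, and for each of
them the starting points in question correspond to points outside \<open>D\<close> that a sequence of translations
tending to the identity moves into \<open>D\<close>. By Fubini's theorem, for almost every starting point almost
every path behaves well. The same argument shows that \<open>r\<^sub>D(t, x, x)\<close> is a measurable function of \<open>x\<close>,
without which its integral over \<open>D\<close> would carry no information.\<close>

section \<open>The Fourier transform of a Gaussian\<close>

text \<open>Rescaling reduces this to the characteristic function of the standard normal distribution.\<close>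

lemma gaussian_fourier_real:
  fixes u x :: real
  assumes "0 < u"
  shows "integrable lborel (\<lambda>\<xi>. iexp (x * \<xi>) * complex_of_real (exp (- u * \<xi>\<^sup>2)))" (is ?i)
    and "(LINT \<xi>|lborel. iexp (x * \<xi>) * complex_of_real (exp (- u * \<xi>\<^sup>2)))
           = complex_of_real (sqrt (pi / u) * exp (- x\<^sup>2 / (4 * u)))" (is ?e)
proof -
  define k where "k = 1 / sqrt (2 * u)"
  have k: "k > 0" "k\<^sup>2 = 1 / (2 * u)" using assms by (auto simp: k_def power_divide)
  define f where "f = (\<lambda>\<xi>. iexp (x * \<xi>) * complex_of_real (exp (- u * \<xi>\<^sup>2)))"
  have f: "f (0 + k * y) = complex_of_real (sqrt (2 * pi)) * (std_normal_density y *\<^sub>R iexp ((x * k) * y))" for y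
    using k assms by (simp add: f_def std_normal_density_def power_mult_distrib scaleR_conv_of_real mult_ac)
  have i0: "integrable lborel (\<lambda>y. std_normal_density y *\<^sub>R iexp ((x * k) * y))"
    by (rule Bochner_Integration.integrable_bound[of _ std_normal_density])
       (auto simp: integrable_std_normal_moment norm_mult)
  have ik: "integrable lborel (\<lambda>y. f (0 + k * y))"
    unfolding f by (intro integrable_mult_right i0)
  show ?i using ik k(1) lborel_integrable_real_affine_iff[of k f 0] unfolding f_def[symmetric] by simp
  have "(LINT y|lborel. std_normal_density y *\<^sub>R iexp ((x * k) * y)) = char std_normal_distribution (x * k)"
    unfolding char_def by (subst integral_density) auto
  also have "\<dots> = complex_of_real (exp (- x\<^sup>2 / (4 * u)))"
    using k by (simp add: char_std_normal_distribution power_mult_distrib)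
  finally have e: "(LINT y|lborel. std_normal_density y *\<^sub>R iexp ((x * k) * y)) = complex_of_real (exp (- x\<^sup>2 / (4 * u)))" .
  have "(LINT \<xi>|lborel. f \<xi>) = \<bar>k\<bar> *\<^sub>R (LINT y|lborel. f (0 + k * y))"
    by (rule lborel_integral_real_affine) (use k in auto)
  also have "\<dots> = complex_of_real (k * sqrt (2 * pi)) * complex_of_real (exp (- x\<^sup>2 / (4 * u)))"
    unfolding f by (subst integral_mult_right_zero) (use k e in \<open>auto simp: scaleR_conv_of_real\<close>)
  also have "k * sqrt (2 * pi) = sqrt (pi / u)"
    using assms by (simp add: k_def real_sqrt_divide real_sqrt_mult)
  finally show ?e by (simp add: f_def)
qed

text \<open>Both the integrand and Lebesgue measure factor over the coordinates.\<close>

lemma gaussian_fourier: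
  fixes x :: "'a::euclidean_space"
  assumes "0 < u"
  shows "integrable lborel (\<lambda>\<xi>. iexp (\<xi> \<bullet> x) * complex_of_real (exp (- u * (norm \<xi>)\<^sup>2)))" (is ?i)
    and "(LINT \<xi>|lborel. iexp (\<xi> \<bullet> x) * complex_of_real (exp (- u * (norm \<xi>)\<^sup>2)))
           = complex_of_real ((pi / u) powr (real DIM('a) / 2) * exp (- (norm x)\<^sup>2 / (4 * u)))" (is ?e)
proof -
  define g where "g = (\<lambda>(b::'a) (r::real). iexp ((x \<bullet> b) * r) * complex_of_real (exp (- u * r\<^sup>2)))"
  have n: "(norm y)\<^sup>2 = (\<Sum>b\<in>Basis. (y \<bullet> b)\<^sup>2)" for y :: 'a
    unfolding power2_norm_eq_inner by (subst euclidean_inner) (simp add: power2_eq_square)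
  have s: "(\<Sum>b\<in>Basis. f b *\<^sub>R b) \<bullet> c = f c" if "c \<in> Basis" for f and c :: 'a
    using that by (simp add: inner_sum_left inner_Basis if_distrib sum.If_cases cong: if_cong)
  have prod: "iexp ((\<Sum>b\<in>Basis. f b *\<^sub>R b) \<bullet> x) * complex_of_real (exp (- u * (norm (\<Sum>b\<in>Basis. f b *\<^sub>R b :: 'a))\<^sup>2))
      = (\<Prod>b\<in>Basis. g b (f b))" for f
  proof -
    have "(\<Sum>b\<in>Basis. f b *\<^sub>R b) \<bullet> x = (\<Sum>b\<in>Basis. (x \<bullet> b) * f b)"
      by (simp add: inner_sum_left inner_commute[of x] mult.commute)
    moreover have "(norm (\<Sum>b\<in>Basis. f b *\<^sub>R b :: 'a))\<^sup>2 = (\<Sum>b\<in>Basis. (f b)\<^sup>2)"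
      unfolding n by (intro sum.cong) (auto simp: s)
    ultimately show ?thesis
      by (simp add: g_def prod.distrib exp_sum sum_distrib_left flip: sum_negf)
  qed
  interpret finite_product_sigma_finite "\<lambda>_::'a. lborel :: real measure" Basis
    by standard auto
  have gi: "integrable lborel (g b)" for b
    unfolding g_def by (rule gaussian_fourier_real[OF assms])
  let ?h = "\<lambda>\<xi>. iexp (\<xi> \<bullet> x) * complex_of_real (exp (- u * (norm \<xi>)\<^sup>2))"
  have m: "(\<lambda>f. \<Sum>b\<in>Basis. f b *\<^sub>R b :: 'a) \<in> measurable (Pi\<^sub>M Basis (\<lambda>b. lborel)) borel" by simp
  have hm: "?h \<in> borel_measurable borel" by measurable
  show ?i
    by (subst lborel_eq, subst integrable_distr_eq[OF m hm], unfold prod, rule product_integrable_prod)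
       (use gi in auto)
  have "(LINT \<xi>|lborel. ?h \<xi>) = (\<Prod>b\<in>Basis. LINT r|lborel. g b r)"
    by (subst lborel_eq, subst integral_distr[OF m hm], unfold prod, rule product_integral_prod)
       (use gi in auto)
  also have "\<dots> = (\<Prod>b\<in>Basis. complex_of_real (sqrt (pi / u) * exp (- (x \<bullet> b)\<^sup>2 / (4 * u))))"
    unfolding g_def by (intro prod.cong refl gaussian_fourier_real(2)[OF assms])
  also have "\<dots> = complex_of_real (sqrt (pi / u) ^ DIM('a) * exp (- (norm x)\<^sup>2 / (4 * u)))"
    unfolding of_real_prod[symmetric] n
    by (simp add: prod.distrib exp_sum[symmetric] sum_divide_distrib sum_negf del: of_real_prod of_real_mult)
  also have "sqrt (pi / u) ^ DIM('a) = (pi / u) powr (real DIM('a) / 2)"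
    using assms by (simp add: powr_half_sqrt[symmetric] powr_powr flip: powr_realpow)
  finally show ?e .
qed

lemma gaussian_integral:
  assumes "0 < u"
  shows "integrable lborel (\<lambda>\<xi>::'a::euclidean_space. exp (- u * (norm \<xi>)\<^sup>2))"
    and "(LINT \<xi>|lborel. exp (- u * (norm (\<xi>::'a))\<^sup>2)) = (pi / u) powr (real DIM('a) / 2)"
proof -
  note * = gaussian_fourier[OF assms, of "0::'a"]
  show "integrable lborel (\<lambda>\<xi>::'a. exp (- u * (norm \<xi>)\<^sup>2))"
    using *(1) by (simp add: complex_of_real_integrable_eq flip: of_real_exp of_real_minus of_real_mult of_real_power)
  show "(LINT \<xi>|lborel. exp (- u * (norm (\<xi>::'a))\<^sup>2)) = (pi / u) powr (real DIM('a) / 2)"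
    using *(2) by (simp flip: of_real_exp of_real_minus of_real_mult of_real_power)
qed

section \<open>Integrals of Gamma type\<close>

text \<open>After division by \<open>(x + y) powr b\<close> this is \<open>r \<le> r powr b\<close> for the two ratios \<open>r\<close>, which add up to 1.\<close>

lemma powr_subadditive:
  fixes x y b :: real
  assumes "0 \<le> x" "0 \<le> y" "0 \<le> b" "b \<le> 1"
  shows "(x + y) powr b \<le> x powr b + y powr b"
proof (cases "x + y = 0")
  case True
  then show ?thesis using assms by simp
next
  case False
  define z where "z = x + y"
  have z: "z > 0" using assms False by (simp add: z_def)
  have le: "r \<le> r powr b" if "0 \<le> r" "r \<le> 1" for r :: real
    using powr_mono'[of b 1 r] that assms by (cases "r = 0") auto
  have "z powr b = z powr b * (x / z + y / z)"
    using z by (simp add: z_def flip: add_divide_distrib)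
  also have "\<dots> \<le> z powr b * ((x / z) powr b + (y / z) powr b)"
    using assms z by (intro mult_left_mono add_mono le) (auto simp: z_def field_simps)
  also have "\<dots> = x powr b + y powr b"
    using assms z by (simp add: powr_divide field_simps)
  finally show ?thesis by (simp add: z_def)
qed

lemma nn_integral_Gamma_exp:
  fixes s u :: real
  assumes "0 < s" "0 < u"
  shows "(\<integral>\<^sup>+l\<in>{0<..}. ennreal (l powr (s - 1) * exp (- l * u)) \<partial>lborel) = ennreal (Gamma s * u powr - s)"
proof -
  let ?f = "\<lambda>l. ennreal (indicator {0..} l * l powr (s - 1) / exp l)"
  have f: "?f (0 + u * l) = ennreal (u powr (s - 1)) * (ennreal (l powr (s - 1) * exp (- l * u)) * indicator {0<..} l)" for l
    using assms by (auto simp: powr_mult exp_minus field_simps indicator_def zero_le_mult_iff simp flip: ennreal_mult)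
  have "ennreal (Gamma s) = (\<integral>\<^sup>+l. ?f l \<partial>lborel)"
    by (rule Gamma_conv_nn_integral_real) fact
  also have "\<dots> = ennreal u * (\<integral>\<^sup>+l. ?f (0 + u * l) \<partial>lborel)"
    using assms by (subst nn_integral_real_affine[where c=u and t=0]) auto
  also have "\<dots> = ennreal u * (ennreal (u powr (s - 1)) * (\<integral>\<^sup>+l\<in>{0<..}. ennreal (l powr (s - 1) * exp (- l * u)) \<partial>lborel))"
    unfolding f by (subst nn_integral_cmult) auto
  also have "\<dots> = ennreal (u powr s) * (\<integral>\<^sup>+l\<in>{0<..}. ennreal (l powr (s - 1) * exp (- l * u)) \<partial>lborel)"
    using assms by (simp add: powr_diff flip: ennreal_mult mult.assoc)
  finally have *: "ennreal (Gamma s) = ennreal (u powr s) * (\<integral>\<^sup>+l\<in>{0<..}. ennreal (l powr (s - 1) * exp (- l * u)) \<partial>lborel)" .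
  have "ennreal (Gamma s * u powr - s) = ennreal (u powr - s) * ennreal (Gamma s)"
    using Gamma_real_pos[OF assms(1)] by (simp add: mult.commute flip: ennreal_mult)
  also have "\<dots> = (\<integral>\<^sup>+l\<in>{0<..}. ennreal (l powr (s - 1) * exp (- l * u)) \<partial>lborel)"
    unfolding * mult.assoc[symmetric] using assms by (simp add: powr_minus flip: ennreal_mult)
  finally show ?thesis by simp
qed

text \<open>The substitution \<open>y = t * l powr b\<close> turns this into the Gamma integral.\<close>

lemma nn_integral_powr_exp_powr:
  fixes s t b :: real
  assumes "0 < s" "0 < t" "0 < b"
  shows "(\<integral>\<^sup>+l\<in>{0<..}. ennreal (l powr (s - 1) * exp (- t * l powr b)) \<partial>lborel)
           = ennreal (Gamma (s / b) / (b * t powr (s / b)))"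
proof -
  let ?S = "{0<..} :: real set"
  define g where "g = (\<lambda>l. t * l powr b)"
  define f where "f = (\<lambda>y::real. y powr (s / b - 1) / exp y)"
  have der: "(g has_field_derivative t * (b * l powr (b - 1))) (at l within ?S)" if "l \<in> ?S" for l
    unfolding g_def using that by (auto intro!: derivative_eq_intros simp: powr_diff)
  have inj: "inj_on g ?S"
    using assms by (intro inj_on_inverseI[of _ "\<lambda>y. (y / t) powr (1 / b)"]) (auto simp: g_def powr_powr)
  have img: "g ` ?S = ?S"
  proof (intro equalityI subsetI)
    fix y :: real assume "y \<in> ?S"
    then show "y \<in> g ` ?S"
      using assms by (intro image_eqI[of _ _ "(y / t) powr (1 / b)"]) (auto simp: g_def powr_powr)
  qed (use assms in \<open>auto simp: g_def\<close>)
  have G: "(f has_integral Gamma (s / b)) ?S"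
  proof -
    have "(f has_integral Gamma (s / b)) {0..}"
      unfolding f_def using Gamma_integral_real[of "s / b"] assms by simp
    then show ?thesis
    proof (rule has_integral_spike_set_eq[THEN iffD1, rotated 2])
      show "negligible {x \<in> {0..} - ?S. f x \<noteq> 0}" by (rule negligible_subset[of "{0}"]) auto
      show "negligible {x \<in> ?S - {0..}. f x \<noteq> 0}" by (rule negligible_subset[of "{}"]) auto
    qed
  qed
  then have "f absolutely_integrable_on g ` ?S \<and> integral (g ` ?S) f = Gamma (s / b)"
    unfolding img by (subst absolutely_integrable_on_iff_nonneg) (auto simp: f_def)
  then have *: "(\<lambda>l. \<bar>t * (b * l powr (b - 1))\<bar> * f (g l)) absolutely_integrable_on ?S \<and>
      integral ?S (\<lambda>l. \<bar>t * (b * l powr (b - 1))\<bar> * f (g l)) = Gamma (s / b)"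
    by (subst has_absolute_integral_change_of_variables_1'[OF _ der inj]) auto
  then have "((\<lambda>l. \<bar>t * (b * l powr (b - 1))\<bar> * f (g l)) has_integral Gamma (s / b)) ?S"
    by (metis has_integral_integral set_lebesgue_integral_eq_integral(1))
  moreover have "\<bar>t * (b * l powr (b - 1))\<bar> * f (g l)
        = b * t powr (s / b) * (l powr (s - 1) * exp (- t * l powr b))" if "l \<in> ?S" for l
  proof -
    have e: "b * (s / b - 1) = s - b" using assms by (simp add: field_simps)
    have ll: "l powr (b - 1) * l powr (s - b) = l powr (s - 1)" by (simp flip: powr_add)
    have tt: "t * t powr (s / b - 1) = t powr (s / b)" using assms by (simp add: powr_diff)
    have "f (g l) = t powr (s / b - 1) * l powr (s - b) * exp (- t * l powr b)"
      using assms that by (simp add: f_def g_def powr_mult powr_powr e exp_minus flip: divide_inverse)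
    moreover have "\<bar>t * (b * l powr (b - 1))\<bar> = t * (b * l powr (b - 1))"
      using assms by simp
    ultimately have "\<bar>t * (b * l powr (b - 1))\<bar> * f (g l)
        = b * (t * t powr (s / b - 1)) * (l powr (b - 1) * l powr (s - b)) * exp (- t * l powr b)"
      by (simp only: mult_ac)
    then show ?thesis unfolding ll tt by (simp only: mult.assoc)
  qed
  ultimately have "((\<lambda>l. b * t powr (s / b) * (l powr (s - 1) * exp (- t * l powr b))) has_integral Gamma (s / b)) ?S"
    by (subst (asm) has_integral_cong) auto
  from has_integral_mult_right[OF this, of "1 / (b * t powr (s / b))"]
  have "((\<lambda>l. l powr (s - 1) * exp (- t * l powr b)) has_integral Gamma (s / b) / (b * t powr (s / b))) ?S"
    using assms by simp
  then show ?thesis by (subst nn_integral_has_integral_lebesgue') auto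
qed

text \<open>The bound follows from \<open>z \<le> exp z\<close> at \<open>z = a * v / k\<close>, raised to the power \<open>k\<close>.\<close>

lemma powr_mult_exp_neg_le:
  fixes v k a :: real
  assumes "0 < v" "0 < k" "0 < a"
  shows "v powr k * exp (- (a * v)) \<le> (k / a) powr k"
proof -
  have "(a * v / k) powr k \<le> exp (a * v / k) powr k"
    using assms by (intro powr_mono2) (auto intro: order_trans[OF _ exp_ge_add_one_self])
  also have "\<dots> = exp (a * v)" using assms by (simp add: exp_powr_real)
  finally have "(k / a) powr k * (a * v / k) powr k \<le> (k / a) powr k * exp (a * v)"
    by (intro mult_left_mono) auto
  also have "(k / a) powr k * (a * v / k) powr k = v powr k"
    using assms by (simp flip: powr_mult)
  finally show ?thesis by (simp add: exp_minus field_simps)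
qed

section \<open>The relativistic kernel as a mixture of Gaussians\<close>

definition characteristic_exponent :: "real \<Rightarrow> real \<Rightarrow> 'a::euclidean_space \<Rightarrow> real" where
  "characteristic_exponent \<alpha> m \<xi> = (m powr (2 / \<alpha>) + (norm \<xi>)\<^sup>2) powr (\<alpha> / 2) - m"

text \<open>The kernel depends on the subordinator only through the densities \<open>\<theta> t\<close> and their Laplace transforms;
this locale isolates these data. The restriction of the integral to \<open>u > 0\<close> expresses that the
subordinator is almost surely positive.\<close>

locale stable_density =
  fixes \<alpha> m :: real and \<theta> :: "real \<Rightarrow> real \<Rightarrow> real"
  assumes alpha: "0 < \<alpha>" "\<alpha> < 2" and mass: "0 < m"
    and nonneg: "0 < t \<Longrightarrow> 0 \<le> \<theta> t u"
    and borel_density: "0 < t \<Longrightarrow> \<theta> t \<in> borel_measurable borel"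
    and laplace_density: "0 < t \<Longrightarrow> 0 < l \<Longrightarrow>
      (\<integral>\<^sup>+u\<in>{0<..}. ennreal (exp (- l * u) * \<theta> t u) \<partial>lborel) = ennreal (exp (- t * l powr (\<alpha> / 2)))"
begin

abbreviation (input) c :: real where "c \<equiv> m powr (2 / \<alpha>)"

lemma c_pos: "0 < c" and c_powr: "c powr (\<alpha> / 2) = m"
  using mass alpha by (auto simp: powr_powr)

text \<open>Replacing the power of \<open>u\<close> by its Gamma integral and exchanging the integrals leaves the Laplace
transform at \<open>l + c\<close>: negative moments of the subordinator become integrals of its Laplace transform.\<close>

lemma nn_integral_negative_moment:
  assumes t: "0 < t" and s: "0 < s"
  shows "ennreal (Gamma s) * (\<integral>\<^sup>+u\<in>{0<..}. ennreal (u powr - s * exp (- c * u) * \<theta> t u) \<partial>lborel) =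
    (\<integral>\<^sup>+l\<in>{0<..}. ennreal (l powr (s - 1) * exp (- t * (l + c) powr (\<alpha> / 2))) \<partial>lborel)"
proof -
  have [measurable]: "\<theta> t \<in> borel_measurable borel" using borel_density t .
  have th: "0 \<le> \<theta> t u" for u using nonneg t .
  have G: "0 < Gamma s" by (rule Gamma_real_pos) fact
  have "ennreal (Gamma s) * (\<integral>\<^sup>+u\<in>{0<..}. ennreal (u powr - s * exp (- c * u) * \<theta> t u) \<partial>lborel)
      = (\<integral>\<^sup>+u. ennreal (Gamma s * u powr - s) * (ennreal (exp (- c * u) * \<theta> t u) * indicator {0<..} u) \<partial>lborel)"
    using G th by (subst nn_integral_cmult[symmetric]) (auto simp: mult_ac indicator_def simp flip: ennreal_mult intro!: nn_integral_cong)
  also have "\<dots> = (\<integral>\<^sup>+u. (\<integral>\<^sup>+l. ennreal (l powr (s - 1) * exp (- l * u)) * indicator {0<..} l *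
          (ennreal (exp (- c * u) * \<theta> t u) * indicator {0<..} u) \<partial>lborel) \<partial>lborel)"
  proof (intro nn_integral_cong, subst nn_integral_multc)
    fix u :: real
    show "ennreal (Gamma s * u powr - s) * (ennreal (exp (- c * u) * \<theta> t u) * indicator {0<..} u)
        = (\<integral>\<^sup>+l\<in>{0<..}. ennreal (l powr (s - 1) * exp (- l * u)) \<partial>lborel) *
          (ennreal (exp (- c * u) * \<theta> t u) * indicator {0<..} u)"
      by (cases "0 < u") (simp_all only: nn_integral_Gamma_exp[OF s], simp)
  qed auto
  also have "\<dots> = (\<integral>\<^sup>+l. (\<integral>\<^sup>+u. ennreal (l powr (s - 1) * exp (- l * u)) * indicator {0<..} l *
          (ennreal (exp (- c * u) * \<theta> t u) * indicator {0<..} u) \<partial>lborel) \<partial>lborel)"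
    by (rule lborel_pair.Fubini') measurable
  also have "\<dots> = (\<integral>\<^sup>+l. ennreal (l powr (s - 1)) * indicator {0<..} l *
         (\<integral>\<^sup>+u\<in>{0<..}. ennreal (exp (- (l + c) * u) * \<theta> t u) \<partial>lborel) \<partial>lborel)"
    by (intro nn_integral_cong, subst nn_integral_cmult[symmetric])
       (auto simp: indicator_def th algebra_simps exp_add[symmetric] simp flip: ennreal_mult intro!: nn_integral_cong)
  also have "\<dots> = (\<integral>\<^sup>+l. ennreal (l powr (s - 1)) * indicator {0<..} l * ennreal (exp (- t * (l + c) powr (\<alpha> / 2))) \<partial>lborel)"
  proof (intro nn_integral_cong)
    fix l :: real
    have "0 < l \<Longrightarrow> 0 < l + c" using c_pos by (simp only: add_pos_pos)
    then show "ennreal (l powr (s - 1)) * indicator {0<..} l *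
         (\<integral>\<^sup>+u\<in>{0<..}. ennreal (exp (- (l + c) * u) * \<theta> t u) \<partial>lborel)
       = ennreal (l powr (s - 1)) * indicator {0<..} l * ennreal (exp (- t * (l + c) powr (\<alpha> / 2)))"
      by (cases "0 < l") (simp_all only: laplace_density[OF t], simp)
  qed
  finally show ?thesis by (simp add: ennreal_mult mult_ac)
qed


definition gauss_mix :: "real \<Rightarrow> 'a::euclidean_space \<Rightarrow> real \<Rightarrow> real" where
  "gauss_mix t x u = 1 / (4 * pi * u) powr (real DIM('a) / 2) * exp (- (norm x)\<^sup>2 / (4 * u)) *
     exp (- c * u) * \<theta> t u"

lemma rel_kernel_gauss_mix:
  "rel_kernel \<alpha> m \<theta> t (x::'a::euclidean_space) = exp (m * t) * (LINT u:{0<..}|lborel. gauss_mix t x u)"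
  by (simp add: rel_kernel_def gauss_mix_def Let_def)

lemma gauss_mix_measurable: "0 < t \<Longrightarrow> gauss_mix t x \<in> borel_measurable borel"
  using borel_density[of t] unfolding gauss_mix_def by simp

lemma gauss_mix_nonneg: "0 < t \<Longrightarrow> 0 \<le> gauss_mix t x u"
  using nonneg[of t u] by (simp add: gauss_mix_def)

lemma rel_kernel_nonneg:
  assumes "0 < t" shows "0 \<le> rel_kernel \<alpha> m \<theta> t x"
  unfolding rel_kernel_gauss_mix set_lebesgue_integral_def
  using gauss_mix_nonneg[OF assms] by (intro mult_nonneg_nonneg integral_nonneg_AE) (auto simp: indicator_def)

lemma rel_kernel_nn_integral:
  assumes "0 < t"
  shows "rel_kernel \<alpha> m \<theta> t x = exp (m * t) * enn2real (\<integral>\<^sup>+u\<in>{0<..}. ennreal (gauss_mix t x u) \<partial>lborel)"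
proof -
  have [measurable]: "gauss_mix t x \<in> borel_measurable borel" by (rule gauss_mix_measurable) fact
  have "(LINT u:{0<..}|lborel. gauss_mix t x u) = enn2real (\<integral>\<^sup>+u. ennreal (indicator {0<..} u *\<^sub>R gauss_mix t x u) \<partial>lborel)"
    unfolding set_lebesgue_integral_def using gauss_mix_nonneg[OF assms]
    by (intro integral_eq_nn_integral AE_I2 mult_nonneg_nonneg) (auto simp: gauss_mix_nonneg[OF assms])
  also have "(\<integral>\<^sup>+u. ennreal (indicator {0<..} u *\<^sub>R gauss_mix t x u) \<partial>lborel) = (\<integral>\<^sup>+u\<in>{0<..}. ennreal (gauss_mix t x u) \<partial>lborel)"
    by (intro nn_integral_cong) (auto simp: indicator_def)
  finally show ?thesis unfolding rel_kernel_gauss_mix by simp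
qed

text \<open>At distance at least \<open>r\<close> from the origin the Gaussian of variance \<open>2 * u\<close> per coordinate is bounded
uniformly in \<open>u\<close>. What remains of the mixture is the Laplace transform of the subordinator at
\<open>m powr (2 / \<alpha>)\<close>, which is \<open>exp (- t * m)\<close> and cancels the prefactor.\<close>

lemma rel_kernel_away_from_origin:
  fixes x :: "'a::euclidean_space"
  assumes t: "0 < t" and r: "0 < r" and x: "r \<le> norm x"
  shows "rel_kernel \<alpha> m \<theta> t x \<le> (real DIM('a) / (2 * pi * r\<^sup>2)) powr (real DIM('a) / 2)"
    (is "_ \<le> ?K")
proof -
  let ?s = "real DIM('a) / 2"
  have le: "gauss_mix t x u \<le> ?K * (exp (- c * u) * \<theta> t u)" if u: "0 < u" for u
  proof -
    have "1 / (4 * pi * u) powr ?s * exp (- (norm x)\<^sup>2 / (4 * u))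
        = (1 / (4 * pi * u)) powr ?s * exp (- (pi * (norm x)\<^sup>2 * (1 / (4 * pi * u))))"
      using u by (simp add: powr_divide)
    also have "\<dots> \<le> (1 / (4 * pi * u)) powr ?s * exp (- (pi * r\<^sup>2 * (1 / (4 * pi * u))))"
      using u x r by (intro mult_left_mono) (auto intro!: divide_right_mono power_mono)
    also have "\<dots> \<le> (?s / (pi * r\<^sup>2)) powr ?s"
      using u r by (intro powr_mult_exp_neg_le) auto
    finally show ?thesis
      unfolding gauss_mix_def mult.assoc[of _ "exp (- c * u)"]
      using nonneg[OF t, of u] by (intro mult_right_mono) (auto simp: mult_ac)
  qed
  have [measurable]: "\<theta> t \<in> borel_measurable borel" using borel_density t .
  have "(\<integral>\<^sup>+u\<in>{0<..}. ennreal (gauss_mix t x u) \<partial>lborel) \<le>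
      (\<integral>\<^sup>+u. ennreal ?K * (ennreal (exp (- c * u) * \<theta> t u) * indicator {0<..} u) \<partial>lborel)"
    using le nonneg[OF t] by (intro nn_integral_mono) (auto simp: indicator_def simp flip: ennreal_mult intro!: ennreal_leI)
  also have "\<dots> = ennreal ?K * ennreal (exp (- t * m))"
    by (subst nn_integral_cmult, measurable) (simp only: laplace_density[OF t c_pos] c_powr)
  finally have "enn2real (\<integral>\<^sup>+u\<in>{0<..}. ennreal (gauss_mix t x u) \<partial>lborel) \<le> ?K * exp (- t * m)"
    by (intro enn2real_leI) (auto simp: ennreal_mult)
  then have "rel_kernel \<alpha> m \<theta> t x \<le> exp (m * t) * (?K * exp (- t * m))"
    unfolding rel_kernel_nn_integral[OF t] by (intro mult_left_mono) auto
  also have "\<dots> = ?K" by (simp add: exp_minus mult_ac)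
  finally show ?thesis .
qed

text \<open>These bounds are where the constant of the heat trace comes from: as \<open>t\<close> tends to 0 they coincide.
Finiteness of \<open>J\<close> also gives the integrability that the Fourier representation needs.\<close>

lemma rel_kernel_origin:
  fixes t :: real
  assumes t: "0 < t"
  defines "J \<equiv> (\<integral>\<^sup>+u\<in>{0<..}. ennreal (gauss_mix t (0::'a::euclidean_space) u) \<partial>lborel)"
    and "A \<equiv> C1 DIM('a) \<alpha>"
  shows "J < \<infinity>"
    and "t powr (real DIM('a) / \<alpha>) * exp (- m * t) * rel_kernel \<alpha> m \<theta> t (0::'a) \<le> A"
    and "A * exp (- m * t) \<le> t powr (real DIM('a) / \<alpha>) * exp (- m * t) * rel_kernel \<alpha> m \<theta> t (0::'a)"
proof -
  define s where "s = real DIM('a) / 2"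
  define b where "b = \<alpha> / 2"
  have s: "0 < s" and b: "0 < b" "b \<le> 1" using alpha by (auto simp: s_def b_def)
  have sb: "s / b = real DIM('a) / \<alpha>" by (simp add: s_def b_def)
  have G: "0 < Gamma s" "0 < Gamma (s / b)" using s b by (auto intro!: Gamma_real_pos)
  have [measurable]: "\<theta> t \<in> borel_measurable borel" using borel_density t .
  define I where "I = (\<integral>\<^sup>+l\<in>{0<..}. ennreal (l powr (s - 1) * exp (- t * (l + c) powr b)) \<partial>lborel)"
  define B where "B = Gamma (s / b) / (b * t powr (s / b))"
  have B: "0 < B" using G b t by (simp add: B_def)
  have I_le: "I \<le> ennreal B"
    unfolding I_def B_def nn_integral_powr_exp_powr[OF s t b(1), symmetric]
  proof (intro nn_integral_mono)
    fix l :: real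
    have "l powr b \<le> (l + c) powr b" if "0 < l"
      using that c_pos b by (intro powr_mono2) auto
    then show "ennreal (l powr (s - 1) * exp (- t * (l + c) powr b)) * indicator {0<..} l
        \<le> ennreal (l powr (s - 1) * exp (- t * l powr b)) * indicator {0<..} l"
      using t by (auto simp: indicator_def intro!: ennreal_leI mult_left_mono)
  qed
  have I_ge: "ennreal (exp (- t * m) * B) \<le> I"
  proof -
    have "ennreal (exp (- t * m) * B) = (\<integral>\<^sup>+l. ennreal (exp (- t * m)) * (ennreal (l powr (s - 1) * exp (- t * l powr b)) * indicator {0<..} l) \<partial>lborel)"
      using B by (subst nn_integral_cmult, measurable)
        (simp only: nn_integral_powr_exp_powr[OF s t b(1)] B_def[symmetric], rule ennreal_mult, auto)
    also have "\<dots> \<le> I"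
      unfolding I_def
    proof (intro nn_integral_mono)
      fix l :: real
      have "- t * (l powr b + m) \<le> - t * (l + c) powr b" if "0 < l"
        using powr_subadditive[of l c b] t b c_pos c_powr that by (simp add: b_def)
      then have "exp (- t * m) * exp (- t * l powr b) \<le> exp (- t * (l + c) powr b)" if "0 < l"
        using that by (simp add: distrib_left flip: exp_add)
      then have "exp (- t * m) * (l powr (s - 1) * exp (- t * l powr b)) \<le> l powr (s - 1) * exp (- t * (l + c) powr b)" if "0 < l"
        using mult_left_mono[of "exp (- t * m) * exp (- t * l powr b)" _ "l powr (s - 1)"] that
        by (simp only: mult.left_commute[of "exp (- t * m)"] powr_ge_zero)
      then show "ennreal (exp (- t * m)) * (ennreal (l powr (s - 1) * exp (- t * l powr b)) * indicator {0<..} l)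
          \<le> ennreal (l powr (s - 1) * exp (- t * (l + c) powr b)) * indicator {0<..} l"
        by (cases "0 < l") (simp_all add: ennreal_mult'[symmetric] ennreal_leI del: mult_minus_left)
    qed
    finally show ?thesis .
  qed
  \<comment> \<open>\<open>q\<close> collects the normalisation of the Gaussian and of the Gamma integral.\<close>
  define q where "q = (4 * pi) powr - s / Gamma s"
  have q: "0 < q" using G by (simp add: q_def)
  have J: "J = ennreal q * I"
  proof -
    have "J = (\<integral>\<^sup>+u. ennreal ((4 * pi) powr - s) * (ennreal (u powr - s * exp (- c * u) * \<theta> t u) * indicator {0<..} u) \<partial>lborel)"
      unfolding J_def
    proof (intro nn_integral_cong)
      fix u :: real
      have "gauss_mix t (0::'a) u = (4 * pi) powr - s * (u powr - s * exp (- c * u) * \<theta> t u)" if "0 < u"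
        using that unfolding gauss_mix_def s_def[symmetric] powr_minus_divide by (simp add: powr_mult)
      then show "ennreal (gauss_mix t (0::'a) u) * indicator {0<..} u
          = ennreal ((4 * pi) powr - s) * (ennreal (u powr - s * exp (- c * u) * \<theta> t u) * indicator {0<..} u)"
        by (cases "0 < u") (simp_all add: ennreal_mult'[symmetric])
    qed
    also have "\<dots> = ennreal ((4 * pi) powr - s) * (\<integral>\<^sup>+u\<in>{0<..}. ennreal (u powr - s * exp (- c * u) * \<theta> t u) \<partial>lborel)"
      by (intro nn_integral_cmult) auto
    also have "\<dots> = ennreal q * (ennreal (Gamma s) * (\<integral>\<^sup>+u\<in>{0<..}. ennreal (u powr - s * exp (- c * u) * \<theta> t u) \<partial>lborel))"
      using G by (simp add: q_def flip: mult.assoc ennreal_mult)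
    also have "\<dots> = ennreal q * I"
      unfolding nn_integral_negative_moment[OF t s] I_def b_def ..
    finally show ?thesis .
  qed
  have J_le: "J \<le> ennreal (q * B)"
    unfolding J using I_le q B by (auto simp: ennreal_mult intro!: mult_left_mono)
  have J_ge: "ennreal (q * (exp (- t * m) * B)) \<le> J"
    unfolding J using I_ge q B by (subst ennreal_mult) (auto intro!: mult_left_mono)
  show fin: "J < \<infinity>" using J_le by (simp add: le_less_trans)
  have r_le: "enn2real J \<le> q * B" using J_le q B by (intro enn2real_leI) auto
  have r_ge: "q * (exp (- t * m) * B) \<le> enn2real J" using enn2real_mono[OF J_ge] fin q B by simp
  have P: "exp (- m * t) * rel_kernel \<alpha> m \<theta> t (0::'a) = enn2real J"
    unfolding rel_kernel_nn_integral[OF t] J_def by (simp add: exp_minus)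
  have A: "t powr (s / b) * (q * B) = A"
  proof -
    have "A = 2 * pi powr s / Gamma s * Gamma (s / b) / ((2 * pi) powr (2 * s) * \<alpha>)"
      unfolding A_def C1_def sphere_area_def sb unfolding s_def by (simp add: powr_realpow)
    also have "(2 * pi) powr (2 * s) = (4 * pi) powr s * pi powr s"
    proof -
      have "(2 * pi) powr (2 * s) = ((2 * pi) powr 2) powr s" by (simp only: powr_powr)
      also have "(2 * pi) powr 2 = (4 * pi) * pi" by (simp add: power2_eq_square)
      finally show ?thesis by (simp add: powr_mult)
    qed
    finally have "A = 2 * Gamma (s / b) / (Gamma s * (4 * pi) powr s * \<alpha>)" by simp
    then show ?thesis using t b by (simp add: q_def B_def b_def powr_minus field_simps)
  qed
  show "t powr (real DIM('a) / \<alpha>) * exp (- m * t) * rel_kernel \<alpha> m \<theta> t (0::'a) \<le> A"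
    unfolding mult.assoc P A[symmetric] sb by (intro mult_left_mono r_le) auto
  have "A * exp (- m * t) = t powr (s / b) * (q * (exp (- t * m) * B))"
    unfolding A[symmetric] by (simp add: mult_ac)
  also have "\<dots> \<le> t powr (real DIM('a) / \<alpha>) * enn2real J"
    unfolding sb by (intro mult_left_mono r_ge) auto
  finally show "A * exp (- m * t) \<le> t powr (real DIM('a) / \<alpha>) * exp (- m * t) * rel_kernel \<alpha> m \<theta> t (0::'a)"
    unfolding mult.assoc P .
qed

end

section \<open>Fourier representation and continuity of the kernel\<close>

context stable_density
begin

lemma laplace_density_real:
  assumes t: "0 < t" and r: "0 \<le> r"
  shows "(LINT u|lborel. indicator {0<..} u * (exp (- c * u) * \<theta> t u) * exp (- u * r))
    = exp (- t * (c + r) powr (\<alpha> / 2))"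
proof -
  have [measurable]: "\<theta> t \<in> borel_measurable borel" using borel_density t .
  have "(LINT u|lborel. indicator {0<..} u * (exp (- c * u) * \<theta> t u) * exp (- u * r))
      = enn2real (\<integral>\<^sup>+u. ennreal (indicator {0<..} u * (exp (- c * u) * \<theta> t u) * exp (- u * r)) \<partial>lborel)"
    using nonneg[OF t] by (intro integral_eq_nn_integral AE_I2 mult_nonneg_nonneg) auto
  also have "(\<integral>\<^sup>+u. ennreal (indicator {0<..} u * (exp (- c * u) * \<theta> t u) * exp (- u * r)) \<partial>lborel)
      = (\<integral>\<^sup>+u\<in>{0<..}. ennreal (exp (- (c + r) * u) * \<theta> t u) \<partial>lborel)"
  proof (intro nn_integral_cong)
    fix u :: real
    have "exp (- (c + r) * u) = exp (- c * u) * exp (- u * r)"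
      by (simp add: algebra_simps flip: exp_add)
    then show "ennreal (indicator {0<..} u * (exp (- c * u) * \<theta> t u) * exp (- u * r))
        = ennreal (exp (- (c + r) * u) * \<theta> t u) * indicator {0<..} u"
      by (cases "0 < u") (simp_all add: mult_ac)
  qed
  also have "\<dots> = ennreal (exp (- t * (c + r) powr (\<alpha> / 2)))"
    using c_pos r by (intro laplace_density t add_pos_nonneg)
  finally show ?thesis by simp
qed

text \<open>The Gaussian factor of the mixture is the Fourier integral of \<open>exp (- u * (norm \<xi>)\<^sup>2)\<close>. After exchanging
the integrals, the integral over \<open>u\<close> is the Laplace transform of the subordinator at
\<open>m powr (2 / \<alpha>) + (norm \<xi>)\<^sup>2\<close>, which after
multiplication by \<open>exp (m * t)\<close> is the characteristic function of the process.\<close>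

lemma rel_kernel_fourier:
  fixes x :: "'a::euclidean_space"
  assumes t: "0 < t"
  shows "integrable lborel (\<lambda>\<xi>::'a. exp (- t * characteristic_exponent \<alpha> m \<xi>))"
    and "complex_of_real (rel_kernel \<alpha> m \<theta> t x) = complex_of_real (1 / (2 * pi) ^ DIM('a)) *
      (LINT \<xi>|lborel. iexp (\<xi> \<bullet> x) * complex_of_real (exp (- t * characteristic_exponent \<alpha> m \<xi>)))"
proof -
  let ?d = "(2 * pi) ^ DIM('a)"
  have [measurable]: "\<theta> t \<in> borel_measurable borel" using borel_density t .
  define E where "E = (\<lambda>u. indicator {0<..} u * (exp (- c * u) * \<theta> t u))"
  have E[measurable]: "E \<in> borel_measurable borel" unfolding E_def by measurable
  have E0: "0 \<le> E u" for u using nonneg[OF t, of u] by (simp add: E_def)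
  have E_neg: "E u = 0" if "\<not> 0 < u" for u using that by (simp add: E_def)
  define F where "F = (\<lambda>x u (\<xi>::'a). complex_of_real (E u) * (iexp (\<xi> \<bullet> x) * complex_of_real (exp (- u * (norm \<xi>)\<^sup>2))))"
  have g: "E u * ((pi / u) powr (real DIM('a) / 2) * exp (- (norm x)\<^sup>2 / (4 * u)))
      = ?d * (indicator {0<..} u * gauss_mix t x u)" for u and x :: 'a
  proof (cases "0 < u")
    case True
    have "pi / u = (2 * pi)\<^sup>2 * (1 / (4 * pi * u))"
      using True by (simp add: power2_eq_square field_simps)
    then have "(pi / u) powr (real DIM('a) / 2) = ((2 * pi)\<^sup>2) powr (real DIM('a) / 2) * (1 / (4 * pi * u)) powr (real DIM('a) / 2)"
      using True by (simp only: powr_mult)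
    also have "((2 * pi)\<^sup>2) powr (real DIM('a) / 2) = ?d"
    proof -
      have "((2 * pi)\<^sup>2) powr (real DIM('a) / 2) = ((2 * pi) powr 2) powr (real DIM('a) / 2)" by simp
      also have "\<dots> = (2 * pi) powr real DIM('a)" by (simp only: powr_powr) simp
      finally show ?thesis by (simp add: powr_realpow)
    qed
    also have "(1 / (4 * pi * u)) powr (real DIM('a) / 2) = 1 / (4 * pi * u) powr (real DIM('a) / 2)"
      using True by (simp add: powr_divide)
    finally show ?thesis using True by (simp add: E_def gauss_mix_def)
  qed (simp add: E_neg)
  have F_int: "integrable lborel (F x u)" for x u
    using gaussian_fourier(1)[of u x] by (cases "0 < u") (auto simp: F_def E_neg)
  have F_xi: "(LINT \<xi>|lborel. F x u \<xi>) = complex_of_real (?d * (indicator {0<..} u * gauss_mix t x u))" for x u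
    unfolding g[symmetric] using gaussian_fourier(2)[of u x] by (cases "0 < u") (auto simp: F_def E_neg)
  have F_norm: "(LINT \<xi>|lborel. norm (F x u \<xi>)) = ?d * (indicator {0<..} u * gauss_mix t (0::'a) u)" for x u
  proof -
    have "norm (F x u \<xi>) = E u * exp (- u * (norm \<xi>)\<^sup>2)" for \<xi>
      using E0[of u] by (simp add: F_def norm_mult)
    then show ?thesis
      unfolding g[symmetric] using gaussian_integral(2)[of u, where ?'a = 'a]
      by (cases "0 < u") (auto simp: E_neg)
  qed
  have mix_int: "integrable lborel (\<lambda>u. indicator {0<..} u * gauss_mix t (0::'a) u)"
  proof (rule integrableI_nonneg)
    have "(\<integral>\<^sup>+u. ennreal (indicator {0<..} u * gauss_mix t (0::'a) u) \<partial>lborel)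
        = (\<integral>\<^sup>+u\<in>{0<..}. ennreal (gauss_mix t (0::'a) u) \<partial>lborel)"
      by (intro nn_integral_cong) (auto simp: indicator_def)
    then show "(\<integral>\<^sup>+u. ennreal (indicator {0<..} u * gauss_mix t (0::'a) u) \<partial>lborel) < \<infinity>"
      using rel_kernel_origin(1)[OF t, where ?'a = 'a] by simp
  qed (use gauss_mix_measurable[OF t, of "0::'a"] gauss_mix_nonneg[OF t, of "0::'a"] in auto)
  have FF: "integrable (lborel \<Otimes>\<^sub>M lborel) (case_prod (F x))" for x
  proof (rule lborel_pair.Fubini_integrable)
    show "case_prod (F x) \<in> borel_measurable (lborel \<Otimes>\<^sub>M lborel)"
      unfolding F_def by measurable
  qed (auto simp: F_norm F_int mix_int)
  have F_u: "(LINT u|lborel. F x u \<xi>) = iexp (\<xi> \<bullet> x) * complex_of_real (exp (- t * (c + (norm \<xi>)\<^sup>2) powr (\<alpha> / 2)))" for x \<xi>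
  proof -
    have "(LINT u|lborel. F x u \<xi>) = (LINT u|lborel. iexp (\<xi> \<bullet> x) * complex_of_real (E u * exp (- u * (norm \<xi>)\<^sup>2)))"
      by (simp add: F_def mult_ac)
    also have "\<dots> = iexp (\<xi> \<bullet> x) * complex_of_real (LINT u|lborel. E u * exp (- u * (norm \<xi>)\<^sup>2))"
      by (simp only: integral_mult_right_zero integral_complex_of_real)
    also have "(LINT u|lborel. E u * exp (- u * (norm \<xi>)\<^sup>2)) = exp (- t * (c + (norm \<xi>)\<^sup>2) powr (\<alpha> / 2))"
      unfolding E_def by (rule laplace_density_real[OF t]) simp
    finally show ?thesis .
  qed
  have ex: "exp (- t * characteristic_exponent \<alpha> m \<xi>) = exp (m * t) * exp (- t * (c + (norm \<xi>)\<^sup>2) powr (\<alpha> / 2))" for \<xi> :: 'a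
    by (simp add: characteristic_exponent_def algebra_simps flip: exp_add)
  have "integrable lborel (\<lambda>\<xi>. norm (LINT u|lborel. F 0 u \<xi>))"
    using lborel_pair.integrable_snd[OF FF[of 0]] by (rule integrable_norm)
  then show "integrable lborel (\<lambda>\<xi>::'a. exp (- t * characteristic_exponent \<alpha> m \<xi>))"
    unfolding F_u ex by (simp add: norm_mult)
  have "(LINT \<xi>|lborel. LINT u|lborel. F x u \<xi>) = (LINT u|lborel. LINT \<xi>|lborel. F x u \<xi>)"
    by (rule lborel_pair.Fubini_integral[OF FF])
  also have "\<dots> = complex_of_real (?d * (LINT u:{0<..}|lborel. gauss_mix t x u))"
    unfolding F_xi set_lebesgue_integral_def real_scaleR_def
    by (simp only: integral_mult_right_zero integral_complex_of_real)
  finally have *: "(LINT \<xi>|lborel. iexp (\<xi> \<bullet> x) * complex_of_real (exp (- t * (c + (norm \<xi>)\<^sup>2) powr (\<alpha> / 2))))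
      = complex_of_real (?d * (LINT u:{0<..}|lborel. gauss_mix t x u))"
    unfolding F_u .
  have "(LINT \<xi>|lborel. iexp (\<xi> \<bullet> x) * complex_of_real (exp (- t * characteristic_exponent \<alpha> m \<xi>)))
      = complex_of_real (exp (m * t)) * complex_of_real (?d * (LINT u:{0<..}|lborel. gauss_mix t x u))"
    unfolding ex *[symmetric] unfolding of_real_mult mult.left_commute[of "iexp _"] by (rule integral_mult_right_zero)
  then show "complex_of_real (rel_kernel \<alpha> m \<theta> t x) = complex_of_real (1 / ?d) *
      (LINT \<xi>|lborel. iexp (\<xi> \<bullet> x) * complex_of_real (exp (- t * characteristic_exponent \<alpha> m \<xi>)))"
    by (simp add: rel_kernel_gauss_mix)
qed

lemma characteristic_exponent_nonneg: "0 \<le> characteristic_exponent \<alpha> m (\<xi>::'a::euclidean_space)"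
proof -
  have "c powr (\<alpha> / 2) \<le> (c + (norm \<xi>)\<^sup>2) powr (\<alpha> / 2)"
    using alpha c_pos by (intro powr_mono2) auto
  then show ?thesis by (simp add: characteristic_exponent_def c_powr)
qed

text \<open>Dominated convergence in the Fourier representation; for times above \<open>t / 2\<close> the integrand is
dominated by its modulus at time \<open>t / 2\<close>.\<close>

lemma tendsto_rel_kernel:
  fixes x :: "nat \<Rightarrow> 'a::euclidean_space"
  assumes T: "T \<longlonglongrightarrow> t" and t: "0 < t" and x: "x \<longlonglongrightarrow> y"
  shows "(\<lambda>n. rel_kernel \<alpha> m \<theta> (T n) (x n)) \<longlonglongrightarrow> rel_kernel \<alpha> m \<theta> t y"
proof -
  have "eventually (\<lambda>n. t / 2 < T n) sequentially"
    using t by (intro order_tendstoD(1)[OF T]) simp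
  then obtain N where N: "\<And>n. N \<le> n \<Longrightarrow> t / 2 < T n"
    by (auto simp: eventually_sequentially)
  let ?f = "\<lambda>t x \<xi>. iexp (\<xi> \<bullet> x) * complex_of_real (exp (- t * characteristic_exponent \<alpha> m (\<xi>::'a)))"
  have lim: "(\<lambda>n. LINT \<xi>|lborel. ?f (T (n + N)) (x (n + N)) \<xi>) \<longlonglongrightarrow> (LINT \<xi>|lborel. ?f t y \<xi>)"
  proof (rule integral_dominated_convergence)
    show "integrable lborel (\<lambda>\<xi>::'a. exp (- (t / 2) * characteristic_exponent \<alpha> m \<xi>))"
      using t by (intro rel_kernel_fourier(1)) simp
    show "AE \<xi> in lborel. (\<lambda>n. ?f (T (n + N)) (x (n + N)) \<xi>) \<longlonglongrightarrow> ?f t y \<xi>"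
      using LIMSEQ_ignore_initial_segment[OF T, of N] LIMSEQ_ignore_initial_segment[OF x, of N]
      by (intro AE_I2 tendsto_intros)
    show "AE \<xi> in lborel. norm (?f (T (n + N)) (x (n + N)) \<xi>) \<le> exp (- (t / 2) * characteristic_exponent \<alpha> m \<xi>)" for n
    proof (rule AE_I2)
      fix \<xi> :: 'a
      have "t / 2 * characteristic_exponent \<alpha> m \<xi> \<le> T (n + N) * characteristic_exponent \<alpha> m \<xi>"
        using N[of "n + N"] by (intro mult_right_mono characteristic_exponent_nonneg) simp
      then show "norm (?f (T (n + N)) (x (n + N)) \<xi>) \<le> exp (- (t / 2) * characteristic_exponent \<alpha> m \<xi>)"
        by (simp add: norm_mult)
    qed
  qed (simp_all add: characteristic_exponent_def)
  have TN: "0 < T (n + N)" for n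
    using N[of "n + N"] t by simp
  from lim have "(\<lambda>n. complex_of_real (rel_kernel \<alpha> m \<theta> (T (n + N)) (x (n + N)))) \<longlonglongrightarrow> complex_of_real (rel_kernel \<alpha> m \<theta> t y)"
    unfolding rel_kernel_fourier(2)[OF t] rel_kernel_fourier(2)[OF TN] by (rule tendsto_mult_left)
  then show ?thesis
    unfolding tendsto_of_real_iff by (rule LIMSEQ_offset)
qed

lemma rel_kernel_measurable:
  assumes "0 < t" shows "rel_kernel \<alpha> m \<theta> t \<in> borel_measurable borel"
  by (intro borel_measurable_continuous_onI continuous_on_sequentiallyI tendsto_rel_kernel)
     (auto simp: assms)

end

section \<open>Exit times of right-continuous paths\<close>

text \<open>The cap at \<open>t\<close> keeps the infimum real: the value \<open>t\<close> stands for no hit before \<open>t\<close>.\<close>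

definition hit_before :: "real \<Rightarrow> 'a set \<Rightarrow> (real \<Rightarrow> 'a) \<Rightarrow> real" where
  "hit_before t G f = Inf (insert t {s. 0 \<le> s \<and> s < t \<and> f s \<in> G})"

lemma hit_before_bounds:
  assumes "0 < t" shows "0 \<le> hit_before t G f" and "hit_before t G f \<le> t"
  using assms unfolding hit_before_def
  by (auto intro!: cInf_greatest cInf_lower bdd_belowI[of _ 0])

lemma hit_before_le: "0 < t \<Longrightarrow> 0 \<le> s \<Longrightarrow> f s \<in> G \<Longrightarrow> hit_before t G f \<le> s"
  using hit_before_bounds(2)[of t G f] unfolding hit_before_def
  by (cases "s < t") (auto intro!: cInf_lower bdd_belowI[of _ 0])

lemma hit_before_less_iff:
  assumes "0 < t" "a \<le> t"
  shows "hit_before t G f < a \<longleftrightarrow> (\<exists>s. 0 \<le> s \<and> s < a \<and> f s \<in> G)"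
  unfolding hit_before_def
  by (subst cInf_less_iff) (use assms in \<open>auto intro!: bdd_belowI[of _ 0]\<close>)

lemma hit_before_antimono:
  assumes "0 < t" "G \<subseteq> H" shows "hit_before t H f \<le> hit_before t G f"
  unfolding hit_before_def using assms by (intro cInf_superset_mono) (auto intro!: bdd_belowI[of _ 0])

lemma exit_time_less_iff: "exit_time U f < ereal t \<longleftrightarrow> (\<exists>s. 0 \<le> s \<and> s < t \<and> f s \<notin> U)"
  by (auto simp: exit_time_def Inf_less_iff)

lemma exit_time_eq_hit_before:
  assumes "exit_time U f < ereal t" and t: "0 < t"
  shows "real_of_ereal (exit_time U f) = hit_before t (- U) f"
proof -
  let ?E = "exit_time U f" and ?h = "hit_before t (- U) f"
  obtain s where s: "0 \<le> s" "s < t" "f s \<notin> U"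
    using assms by (auto simp: exit_time_less_iff)
  have ge: "ereal ?h \<le> ?E"
    unfolding exit_time_def using hit_before_le[OF t, of _ f "- U"] by (intro Inf_greatest) auto
  have le: "?E \<le> ereal r" if "0 \<le> r" "f r \<notin> U" for r
    unfolding exit_time_def using that by (intro Inf_lower) auto
  obtain r where r: "?E = ereal r"
    using ge le[OF s(1,3)] by (cases ?E) auto
  have "r \<le> ?h"
    unfolding hit_before_def using le r s(1,2) le[OF s(1,3)] by (intro cInf_greatest) auto
  then show ?thesis using ge r by simp
qed

lemma cadlag_tendsto_from_right:
  assumes "cadlag f" "0 \<le> a" "r \<longlonglongrightarrow> a" "eventually (\<lambda>n. a \<le> r n) sequentially"
  shows "(\<lambda>n. f (r n)) \<longlonglongrightarrow> f a"
proof -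
  have "continuous (at a within {a..}) f"
    using assms(1,2) unfolding cadlag_def continuous_within at_within_Ici_at_right by blast
  from continuous_within_tendsto_compose[OF this, of r sequentially] assms(3,4)
  show ?thesis by auto
qed

lemma cadlag_stays_in_open:
  fixes f :: "real \<Rightarrow> 'a::metric_space"
  assumes "cadlag f" "0 \<le> s" "open G" "f s \<in> G"
  obtains \<eta> where "0 < \<eta>" "\<And>r. s \<le> r \<Longrightarrow> r < s + \<eta> \<Longrightarrow> f r \<in> G"
proof -
  have "(f \<longlongrightarrow> f s) (at_right s)" using assms(1,2) by (auto simp: cadlag_def)
  then have "eventually (\<lambda>r. f r \<in> G) (at_right s)" using assms(3,4) by (rule topological_tendstoD)
  then obtain b where "s < b" "\<And>r. s < r \<Longrightarrow> r < b \<Longrightarrow> f r \<in> G"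
    by (auto simp: eventually_at_right_field)
  then show ?thesis using assms(4) by (intro that[of "b - s"]) (auto simp: le_less)
qed

lemma cadlag_translate:
  fixes f :: "real \<Rightarrow> 'a::topological_monoid_add"
  assumes "cadlag f" shows "cadlag (\<lambda>s. x + f s)"
  unfolding cadlag_def
proof (intro conjI allI impI)
  fix s :: real
  show "((\<lambda>s. x + f s) \<longlongrightarrow> x + f s) (at_right s)" if "0 \<le> s"
    using assms that by (intro tendsto_add tendsto_const) (auto simp: cadlag_def)
  show "\<exists>l. ((\<lambda>s. x + f s) \<longlongrightarrow> l) (at_left s)" if s: "0 < s"
  proof -
    obtain l where "(f \<longlongrightarrow> l) (at_left s)" using assms s by (auto simp: cadlag_def)
    from tendsto_add[OF tendsto_const this] show ?thesis by blast
  qed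
qed

text \<open>The reward \<open>g\<close> (remaining time, position) collected at the first point of the grid of mesh \<open>t / 2 ^ n\<close>
at which the path is in \<open>G\<close>, and 0 if there is no such grid point before \<open>t\<close>.\<close>

definition grid_stop :: "real \<Rightarrow> nat \<Rightarrow> 'a set \<Rightarrow> (real \<Rightarrow> 'a \<Rightarrow> real) \<Rightarrow> (real \<Rightarrow> 'a) \<Rightarrow> real" where
  "grid_stop t n G g f = (let h = t / 2 ^ n in
     \<Sum>i<2 ^ n. if f (real i * h) \<in> G \<and> (\<forall>j<i. f (real j * h) \<notin> G) then g (t - real i * h) (f (real i * h)) else 0)"

text \<open>A right-continuous path that is in the open set \<open>G\<close> stays there for a while and is therefore caught by a
fine enough grid. Hence the first grid times in \<open>G\<close> approach the hitting time from above, and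
right-continuity carries this over to the positions.\<close>

lemma tendsto_grid_stop:
  fixes f :: "real \<Rightarrow> 'a::metric_space"
  assumes f: "cadlag f" and G: "open G" and t: "0 < t" and hit: "hit_before t G f < t"
    and g: "\<And>r z. r \<longlonglongrightarrow> t - hit_before t G f \<Longrightarrow> z \<longlonglongrightarrow> f (hit_before t G f) \<Longrightarrow>
              (\<lambda>n. g (r n) (z n)) \<longlonglongrightarrow> L"
  shows "(\<lambda>n. grid_stop t n G g f) \<longlonglongrightarrow> L"
proof -
  let ?\<tau> = "hit_before t G f"
  define h where "h = (\<lambda>n::nat. t / 2 ^ n)"
  have h: "0 < h n" for n using t by (simp add: h_def)
  have h0: "h \<longlonglongrightarrow> 0"
    unfolding h_def by (rule LIMSEQ_divide_realpow_zero) simp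
  define \<rho> where "\<rho> = (\<lambda>n. (LEAST i. f (real i * h n) \<in> G))"
  define r where "r = (\<lambda>n. real (\<rho> n) * h n)"
  have close: "eventually (\<lambda>n. f (r n) \<in> G \<and> \<rho> n < 2 ^ n \<and> ?\<tau> \<le> r n \<and> r n < ?\<tau> + e) sequentially"
    if e: "0 < e" for e
  proof -
    define b where "b = min t (?\<tau> + e)"
    have "?\<tau> < b" "b \<le> t" using hit e by (auto simp: b_def)
    then obtain s where s: "0 \<le> s" "s < b" "f s \<in> G"
      using hit_before_less_iff[OF t, of b G f] by auto
    obtain \<eta> where \<eta>: "0 < \<eta>" "\<And>r. s \<le> r \<Longrightarrow> r < s + \<eta> \<Longrightarrow> f r \<in> G"
      using cadlag_stays_in_open[OF f s(1) G s(3)] by blast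
    have "eventually (\<lambda>n. h n < min \<eta> (b - s)) sequentially"
      using h0 s \<eta> by (intro order_tendstoD(2)[OF h0]) auto
    then show ?thesis
    proof eventually_elim
      case (elim n)
      define i where "i = nat \<lceil>s / h n\<rceil>"
      have "s / h n \<le> real i" "real i < s / h n + 1"
        using s(1) h[of n] unfolding i_def by (auto simp: of_nat_nat ceiling_less_iff) linarith+
      then have i: "s \<le> real i * h n" "real i * h n < s + h n"
        using h[of n] by (auto simp: field_simps)
      then have fi: "f (real i * h n) \<in> G" using \<eta>(2) elim by auto
      have "\<rho> n \<le> i" unfolding \<rho>_def using fi by (rule Least_le)
      then have le: "r n \<le> real i * h n" unfolding r_def using h[of n] by (intro mult_right_mono) auto
      have in_G: "f (r n) \<in> G" unfolding r_def \<rho>_def using fi by (rule LeastI)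
      have rb: "r n < b" using le i elim by auto
      then have "real (\<rho> n) * h n < t" using \<open>b \<le> t\<close> by (simp add: r_def)
      then have "real (\<rho> n) < 2 ^ n" using t by (simp add: h_def field_simps)
      then have "\<rho> n < 2 ^ n" by (simp flip: of_nat_less_iff)
      moreover have "?\<tau> \<le> r n"
        using hit_before_le[of t "r n" f G] t in_G h[of n] by (simp add: r_def)
      ultimately show ?case using in_G rb by (auto simp: b_def)
    qed
  qed
  have r_lim: "r \<longlonglongrightarrow> ?\<tau>"
  proof (rule order_tendstoI)
    fix a assume "a < ?\<tau>"
    then show "eventually (\<lambda>n. a < r n) sequentially"
      using close[of 1] by (auto elim: eventually_mono)
  next
    fix a assume "?\<tau> < a"
    then show "eventually (\<lambda>n. r n < a) sequentially"
      using close[of "a - ?\<tau>"] by (auto elim: eventually_mono)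
  qed
  have "(\<lambda>n. f (r n)) \<longlonglongrightarrow> f ?\<tau>"
    using close[of 1] hit_before_bounds(1)[OF t]
    by (intro cadlag_tendsto_from_right[OF f _ r_lim]) (auto elim: eventually_mono)
  then have "(\<lambda>n. g (t - r n) (f (r n))) \<longlonglongrightarrow> L"
    by (intro g tendsto_diff tendsto_const r_lim)
  moreover have "eventually (\<lambda>n. g (t - r n) (f (r n)) = grid_stop t n G g f) sequentially"
    using close[OF zero_less_one]
  proof eventually_elim
    case (elim n)
    have first: "f (real i * h n) \<in> G \<and> (\<forall>j<i. f (real j * h n) \<notin> G) \<longleftrightarrow> i = \<rho> n" for i
    proof
      assume "f (real i * h n) \<in> G \<and> (\<forall>j<i. f (real j * h n) \<notin> G)"
      then show "i = \<rho> n"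
        unfolding \<rho>_def by (intro Least_equality[symmetric]) (auto simp: not_less[symmetric])
    next
      assume "i = \<rho> n"
      then show "f (real i * h n) \<in> G \<and> (\<forall>j<i. f (real j * h n) \<notin> G)"
        using elim unfolding \<rho>_def r_def by (auto dest: not_less_Least)
    qed
    have "grid_stop t n G g f = (\<Sum>i<2 ^ n. if i = \<rho> n then g (t - real i * h n) (f (real i * h n)) else 0)"
      unfolding first[symmetric] unfolding grid_stop_def h_def Let_def ..
    also have "\<dots> = g (t - r n) (f (r n))"
      using elim by (simp add: r_def)
    finally show ?case ..
  qed
  ultimately show ?thesis by (rule Lim_transform_eventually)
qed

text \<open>The open neighbourhood of the complement of \<open>U\<close> of radius \<open>1 / (k + 1)\<close>, which is empty if \<open>U\<close> is everything.\<close>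

definition collar :: "'a::metric_space set \<Rightarrow> nat \<Rightarrow> 'a set" where
  "collar U k = (\<Union>a\<in>- U. ball a (inverse (real (Suc k))))"

lemma open_collar: "open (collar U k)"
  by (auto simp: collar_def)

lemma outside_subset_collar: "- U \<subseteq> collar U k"
  by (auto simp: collar_def)

lemma collar_antimono: "k \<le> l \<Longrightarrow> collar U l \<subseteq> collar U k"
  unfolding collar_def by (intro UN_mono subset_ball) (auto intro!: le_imp_inverse_le)

text \<open>The exceptional behaviour: the path stays in \<open>U\<close> before time \<open>s\<close>, approaches a point outside \<open>U\<close>, and
jumps at time \<open>s\<close>, possibly back into \<open>U\<close>.\<close>

definition jumps_from_outside :: "'a::metric_space set \<Rightarrow> (real \<Rightarrow> 'a) \<Rightarrow> bool" where
  "jumps_from_outside U f \<longleftrightarrow> (\<exists>s>0. \<exists>l. (f \<longlongrightarrow> l) (at_left s) \<and> l \<noteq> f s \<and> l \<notin> U \<and> (\<forall>r. 0 \<le> r \<and> r < s \<longrightarrow> f r \<in> U))"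

definition collar_hit :: "real \<Rightarrow> 'a::metric_space set \<Rightarrow> (real \<Rightarrow> 'a) \<Rightarrow> nat \<Rightarrow> real" where
  "collar_hit t U f k = hit_before t (collar U k) f"

definition collar_hit_lim :: "real \<Rightarrow> 'a::metric_space set \<Rightarrow> (real \<Rightarrow> 'a) \<Rightarrow> real" where
  "collar_hit_lim t U f = (SUP k. collar_hit t U f k)"

context
  fixes f :: "real \<Rightarrow> 'a::metric_space" and U :: "'a set" and t :: real
  assumes f: "cadlag f" and U: "open U" and t: "0 < t"
begin

abbreviation (input) \<tau>k :: "nat \<Rightarrow> real" where "\<tau>k \<equiv> collar_hit t U f"
abbreviation (input) \<sigma> :: real where "\<sigma> \<equiv> collar_hit_lim t U f"

lemma collar_hit_limit:
  shows "\<tau>k \<longlonglongrightarrow> \<sigma>" and "\<And>k. \<tau>k k \<le> \<sigma>" and "incseq \<tau>k" and "\<sigma> \<le> hit_before t (- U) f"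
proof -
  have le: "\<tau>k k \<le> hit_before t (- U) f" for k
    unfolding collar_hit_def by (rule hit_before_antimono[OF t outside_subset_collar])
  show inc: "incseq \<tau>k"
    unfolding collar_hit_def by (intro monoI hit_before_antimono[OF t] collar_antimono)
  have bdd: "bdd_above (range \<tau>k)" using le by (auto intro!: bdd_aboveI)
  show "\<tau>k \<longlonglongrightarrow> \<sigma>" unfolding collar_hit_lim_def by (rule LIMSEQ_incseq_SUP[OF bdd inc])
  show "\<tau>k k \<le> \<sigma>" for k unfolding collar_hit_lim_def by (rule cSUP_upper[OF _ bdd]) simp
  show "\<sigma> \<le> hit_before t (- U) f" unfolding collar_hit_lim_def using le by (intro cSUP_least) auto
qed

text \<open>The hitting time of a collar need not be attained, but by right-continuity the position at that time
has distance less than twice the radius of the collar from the complement, which is closed.\<close>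

lemma collar_limit_outside:
  assumes \<sigma>: "\<sigma> < t" and lim: "(\<lambda>k. f (\<tau>k k)) \<longlonglongrightarrow> z"
  shows "z \<notin> U"
proof -
  have "\<exists>a. a \<notin> U \<and> dist a (f (\<tau>k k)) < 2 * inverse (real (Suc k))" for k
  proof -
    let ?e = "inverse (real (Suc k))"
    have \<tau>: "0 \<le> \<tau>k k" "\<tau>k k < t"
      using hit_before_bounds[OF t] collar_hit_limit(2)[of k] \<sigma> by (auto simp: collar_hit_def)
    obtain \<eta> where \<eta>: "0 < \<eta>" "\<And>r. \<tau>k k \<le> r \<Longrightarrow> r < \<tau>k k + \<eta> \<Longrightarrow> f r \<in> ball (f (\<tau>k k)) ?e"
      using cadlag_stays_in_open[OF f \<tau>(1), of "ball (f (\<tau>k k)) ?e"] by auto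
    have "\<tau>k k < min t (\<tau>k k + \<eta>)" using \<tau> \<eta> by simp
    then obtain s where s: "0 \<le> s" "s < min t (\<tau>k k + \<eta>)" "f s \<in> collar U k"
      using hit_before_less_iff[OF t, of "min t (\<tau>k k + \<eta>)" "collar U k" f] by (auto simp: collar_hit_def)
    have "\<tau>k k \<le> s" unfolding collar_hit_def using t s(1,3) by (rule hit_before_le)
    then have "dist (f (\<tau>k k)) (f s) < ?e" using \<eta>(2)[of s] s by auto
    moreover obtain a where "a \<notin> U" "dist a (f s) < ?e" using s(3) by (auto simp: collar_def)
    ultimately show ?thesis using dist_triangle2[of a "f (\<tau>k k)" "f s"] by force
  qed
  then obtain a where a: "\<And>k. a k \<notin> U" "\<And>k. dist (a k) (f (\<tau>k k)) < 2 * inverse (real (Suc k))"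
    by metis
  have "(\<lambda>k. 2 * inverse (real (Suc k))) \<longlonglongrightarrow> 2 * 0"
    by (intro tendsto_intros LIMSEQ_inverse_real_of_nat)
  then have "(\<lambda>k. dist (a k) (f (\<tau>k k))) \<longlonglongrightarrow> 0"
    unfolding mult_zero_right
    by (rule tendsto_sandwich[OF _ _ tendsto_const, rotated 2]) (simp_all add: a(2) less_imp_le del: of_nat_Suc)
  moreover have "(\<lambda>k. dist (f (\<tau>k k)) z) \<longlonglongrightarrow> 0"
    using lim by (simp flip: tendsto_dist_iff)
  ultimately have "(\<lambda>k. dist (a k) (f (\<tau>k k)) + dist (f (\<tau>k k)) z) \<longlonglongrightarrow> 0 + 0"
    by (rule tendsto_add)
  then have "(\<lambda>k. dist (a k) z) \<longlonglongrightarrow> 0"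
    unfolding add_0_left
    by (rule tendsto_sandwich[OF _ _ tendsto_const, rotated 2]) (simp_all add: dist_triangle)
  then have "a \<longlonglongrightarrow> z" by (subst tendsto_dist_iff)
  then show ?thesis
    using closed_sequentially[of "- U" a z] U a(1) by (auto simp: closed_Compl)
qed

lemma collar_hit_eq_hit:
  assumes \<sigma>: "\<sigma> < t" and lim: "(\<lambda>k. f (\<tau>k k)) \<longlonglongrightarrow> f \<sigma>"
  shows "\<sigma> = hit_before t (- U) f"
proof (rule antisym)
  have "0 \<le> \<sigma>" using hit_before_bounds(1)[OF t] collar_hit_limit(2)[of 0] by (auto simp: collar_hit_def intro: order_trans)
  then show "hit_before t (- U) f \<le> \<sigma>"
    using collar_limit_outside[OF assms] by (intro hit_before_le[OF t]) auto
qed (rule collar_hit_limit)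

text \<open>If the hitting times of the collars reach their limit, the positions are eventually constant. Otherwise
they converge to the left limit, which lies outside \<open>U\<close>; so it is not the value of the path.\<close>

lemma not_tendsto_imp_jumps_from_outside:
  assumes \<sigma>: "\<sigma> < t" and nlim: "\<not> (\<lambda>k. f (\<tau>k k)) \<longlonglongrightarrow> f \<sigma>"
  shows "jumps_from_outside U f"
proof -
  have less: "\<tau>k k < \<sigma>" for k
  proof (rule ccontr)
    assume "\<not> \<tau>k k < \<sigma>"
    then have "\<tau>k l = \<sigma>" if "k \<le> l" for l
      using collar_hit_limit(2)[of l] collar_hit_limit(3) that by (auto simp: incseq_def intro!: antisym order_trans[of \<sigma> "\<tau>k k" "\<tau>k l"])
    then have "(\<lambda>l. f (\<tau>k l)) \<longlonglongrightarrow> f \<sigma>"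
      by (intro tendsto_eventually eventually_sequentiallyI[of k]) simp
    then show False using nlim by simp
  qed
  have "0 \<le> \<tau>k 0" using hit_before_bounds(1)[OF t] by (simp add: collar_hit_def)
  then have pos: "0 < \<sigma>" using less[of 0] by simp
  then obtain l where l: "(f \<longlongrightarrow> l) (at_left \<sigma>)" using f by (auto simp: cadlag_def)
  have "filterlim \<tau>k (at_left \<sigma>) sequentially"
    using collar_hit_limit(1) less by (auto simp: filterlim_at intro!: always_eventually less_imp_neq)
  from filterlim_compose[OF l this] have lim: "(\<lambda>k. f (\<tau>k k)) \<longlonglongrightarrow> l" .
  have "f r \<in> U" if r: "0 \<le> r" "r < \<sigma>" for r
  proof (rule ccontr)
    assume "f r \<notin> U"
    then have "hit_before t (- U) f \<le> r" using r by (intro hit_before_le[OF t]) auto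
    then show False using collar_hit_limit(4) r by simp
  qed
  then show ?thesis
    unfolding jumps_from_outside_def using pos l lim nlim collar_limit_outside[OF \<sigma> lim] by blast
qed

end

section \<open>Jumps from the complement of an open set\<close>

text \<open>Jumps larger than a fixed size cannot accumulate, because one-sided limits exist everywhere.\<close>

lemma countable_jumps:
  fixes f :: "real \<Rightarrow> 'a::metric_space"
  assumes f: "cadlag f"
  shows "countable {s. 0 < s \<and> (\<exists>l. (f \<longlongrightarrow> l) (at_left s) \<and> l \<noteq> f s)}"
proof -
  define J where "J = (\<lambda>k::nat. {s. 0 < s \<and> (\<exists>l. (f \<longlongrightarrow> l) (at_left s) \<and> inverse (real (Suc k)) < dist l (f s))})"
  have jump: "\<exists>e>0. \<forall>s. a < s \<and> s < a + e \<longrightarrow> s \<notin> J k" if a: "0 \<le> a" for a k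
  proof -
    define e where "e = inverse (real (Suc k))"
    have "(f \<longlongrightarrow> f a) (at_right a)" using f a by (auto simp: cadlag_def)
    then have "eventually (\<lambda>s. dist (f s) (f a) < e / 2) (at_right a)"
      by (rule tendstoD) (simp add: e_def)
    then obtain b where b: "a < b" "\<And>s. a < s \<Longrightarrow> s < b \<Longrightarrow> dist (f s) (f a) < e / 2"
      by (auto simp: eventually_at_right_field)
    have "s \<notin> J k" if s: "a < s" "s < b" for s
    proof
      assume "s \<in> J k"
      then obtain l where l: "(f \<longlongrightarrow> l) (at_left s)" "e < dist l (f s)" by (auto simp: J_def e_def)
      have "eventually (\<lambda>r. r \<in> {a<..<s}) (at_left s)"
        using s(1) by (rule eventually_at_left_real)
      then have "eventually (\<lambda>r. dist (f r) (f a) \<le> e / 2) (at_left s)"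
        by eventually_elim (use b s in \<open>auto intro!: less_imp_le\<close>)
      then have "dist l (f a) \<le> e / 2"
        by (intro tendsto_upperbound[OF tendsto_dist[OF l(1) tendsto_const]]) auto
      with b(2)[OF s] l(2) dist_triangle2[of l "f s" "f a"] show False by simp
    qed
    then show ?thesis using b(1) by (intro exI[of _ "b - a"]) auto
  qed
  have jump': "\<exists>e>0. \<forall>s. a - e < s \<and> s < a \<longrightarrow> s \<notin> J k" if a: "0 < a" for a k
  proof -
    define e where "e = inverse (real (Suc k))"
    obtain l' where l': "(f \<longlongrightarrow> l') (at_left a)" using f a by (auto simp: cadlag_def)
    then have "eventually (\<lambda>s. dist (f s) l' < e / 2) (at_left a)"
      by (rule tendstoD) (simp add: e_def)
    then obtain b where b: "b < a" "\<And>s. b < s \<Longrightarrow> s < a \<Longrightarrow> dist (f s) l' < e / 2"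
      by (auto simp: eventually_at_left_field)
    have "s \<notin> J k" if s: "b < s" "s < a" for s
    proof
      assume "s \<in> J k"
      then obtain l where l: "(f \<longlongrightarrow> l) (at_left s)" "e < dist l (f s)" by (auto simp: J_def e_def)
      have "eventually (\<lambda>r. r \<in> {b<..<s}) (at_left s)"
        using s(1) by (rule eventually_at_left_real)
      then have "eventually (\<lambda>r. dist (f r) l' \<le> e / 2) (at_left s)"
        by eventually_elim (use b s in \<open>auto intro!: less_imp_le\<close>)
      then have "dist l l' \<le> e / 2"
        by (intro tendsto_upperbound[OF tendsto_dist[OF l(1) tendsto_const]]) auto
      with b(2)[OF s] l(2) dist_triangle2[of l "f s" l'] show False by simp
    qed
    then show ?thesis using b(1) by (intro exI[of _ "a - b"]) auto
  qed
  have isolated: "\<not> a islimpt J k" if a: "0 \<le> a" for a k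
  proof -
    obtain e1 where e1: "0 < e1" "\<And>s. a < s \<Longrightarrow> s < a + e1 \<Longrightarrow> s \<notin> J k"
      using jump[OF a] by blast
    obtain e2 where e2: "0 < e2" "\<And>s. a - e2 < s \<Longrightarrow> s < a \<Longrightarrow> s \<notin> J k"
    proof (cases "a = 0")
      case True
      then show ?thesis by (intro that[of 1]) (auto simp: J_def)
    next
      case False
      then show ?thesis using jump'[of a k] a that by (metis le_less)
    qed
    have "x \<notin> J k" if "x \<noteq> a" "dist x a < min e1 e2" for x
      using e1(2)[of x] e2(2)[of x] that by (cases "x < a") (auto simp: dist_real_def)
    then show ?thesis
      using e1(1) e2(1) unfolding islimpt_approachable by (metis min_less_iff_conj)
  qed
  have "finite (J k \<inter> {0..real n})" for k n
  proof -
    have "\<not> a islimpt (J k \<inter> {0..real n})" if "a \<in> {0..real n}" for a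
      using isolated[of a k] that islimpt_subset[of a _ "J k"] by auto
    then show ?thesis
      using finite_not_islimpt_in_compact[of "{0..real n}" "J k"] isolated
      by (simp add: Int_commute)
  qed
  then have "countable (J k \<inter> {0..real n})" for k n
    by (rule countable_finite)
  then have "countable (\<Union>k. \<Union>n. J k \<inter> {0..real n})"
    by (intro countable_UN) auto
  moreover have "{s. 0 < s \<and> (\<exists>l. (f \<longlongrightarrow> l) (at_left s) \<and> l \<noteq> f s)} \<subseteq> (\<Union>k. \<Union>n. J k \<inter> {0..real n})"
  proof
    fix s assume "s \<in> {s. 0 < s \<and> (\<exists>l. (f \<longlongrightarrow> l) (at_left s) \<and> l \<noteq> f s)}"
    then obtain l where l: "0 < s" "(f \<longlongrightarrow> l) (at_left s)" "l \<noteq> f s" by auto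
    obtain k where "inverse (real (Suc k)) < dist l (f s)"
      using reals_Archimedean[of "dist l (f s)"] l(3) by auto
    moreover obtain n :: nat where "s \<le> real n" using real_arch_simple by blast
    ultimately show "s \<in> (\<Union>k. \<Union>n. J k \<inter> {0..real n})" using l by (auto simp: J_def)
  qed
  ultimately show ?thesis by (rule countable_subset[rotated])
qed

text \<open>If \<open>S\<close> is this set, every point of \<open>S \<union> D\<close> is eventually mapped into \<open>D\<close> by the translations: the points
of \<open>S\<close> by definition and those of \<open>D\<close> because \<open>D\<close> is open. Translations preserve measure, so by
Fatou's lemma the measure of the disjoint union \<open>S \<union> D\<close> is at most that of \<open>D\<close>.\<close>

lemma null_outside_inside_translates:
  fixes D :: "'a::euclidean_space set" and h :: "nat \<Rightarrow> 'a"
  assumes D: "open D" "emeasure lborel D < \<infinity>" and h: "h \<longlonglongrightarrow> 0"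
  shows "{y. y \<notin> D \<and> (\<forall>n. y + h n \<in> D)} \<in> null_sets lborel"
proof -
  define S where "S = {y. y \<notin> D \<and> (\<forall>n. y + h n \<in> D)}"
  have Db[measurable]: "D \<in> sets borel" using D(1) by simp
  have S[measurable]: "S \<in> sets borel" unfolding S_def by measurable
  have "emeasure lborel S + emeasure lborel D = emeasure lborel (S \<union> D)"
    by (rule plus_emeasure) (auto simp: S_def)
  also have "\<dots> = (\<integral>\<^sup>+y. indicator (S \<union> D) y \<partial>lborel)" by simp
  also have "\<dots> \<le> (\<integral>\<^sup>+y. liminf (\<lambda>n. indicator D (h n + y)) \<partial>lborel)"
  proof (intro nn_integral_mono)
    fix y
    show "indicator (S \<union> D) y \<le> (liminf (\<lambda>n. indicator D (h n + y)) :: ennreal)"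
    proof (cases "y \<in> S \<union> D")
      case True
      have "(\<lambda>n. h n + y) \<longlonglongrightarrow> 0 + y" by (intro tendsto_intros h)
      then have "y \<in> D \<Longrightarrow> eventually (\<lambda>n. h n + y \<in> D) sequentially"
        using topological_tendstoD[OF _ D(1), of "\<lambda>n. h n + y" y] by simp
      then have "eventually (\<lambda>n. h n + y \<in> D) sequentially"
        using True by (auto simp: S_def add.commute)
      then have "eventually (\<lambda>n. (1::ennreal) \<le> indicator D (h n + y)) sequentially"
        by eventually_elim simp
      then have "(1::ennreal) \<le> liminf (\<lambda>n. indicator D (h n + y))"
        by (rule Liminf_bounded)
      then show ?thesis using True by simp
    qed simp
  qed
  also have "\<dots> \<le> liminf (\<lambda>n. \<integral>\<^sup>+y. indicator D (h n + y) \<partial>lborel)"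
    by (rule nn_integral_liminf) measurable
  also have "(\<lambda>n. \<integral>\<^sup>+y. indicator D (h n + y) \<partial>lborel) = (\<lambda>n. emeasure lborel D)"
  proof
    fix n
    have "(\<integral>\<^sup>+y. indicator D (h n + y) \<partial>lborel) = (\<integral>\<^sup>+y. indicator D y \<partial>distr lborel borel ((+) (h n)))"
      by (rule nn_integral_distr[symmetric]) auto
    then show "(\<integral>\<^sup>+y. indicator D (h n + y) \<partial>lborel) = emeasure lborel D" by (simp add: lborel_distr_plus)
  qed
  finally have "emeasure lborel S + emeasure lborel D \<le> emeasure lborel D" by (simp add: Liminf_const)
  then have "emeasure lborel S = 0"
    using D(2) by (cases "emeasure lborel S"; cases "emeasure lborel D") (auto simp: top_unique simp flip: ennreal_plus)
  then show ?thesis unfolding S_def[symmetric] by auto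
qed

text \<open>At a jump time \<open>s\<close> with left limit \<open>l\<close>, an exceptional starting point \<open>x\<close> has \<open>x + l\<close> outside \<open>D\<close>, while the
translations by \<open>f r - l\<close> for \<open>r\<close> increasing to \<open>s\<close> move it into \<open>D\<close>.\<close>

lemma AE_not_jumps_from_outside:
  fixes f :: "real \<Rightarrow> 'a::euclidean_space"
  assumes f: "cadlag f" and D: "open D" "emeasure lborel D < \<infinity>"
  shows "AE x in lborel. \<not> jumps_from_outside D (\<lambda>s. x + f s)"
proof -
  define J where "J = {s. 0 < s \<and> (\<exists>l. (f \<longlongrightarrow> l) (at_left s) \<and> l \<noteq> f s)}"
  have [measurable]: "D \<in> sets borel" using D(1) by simp
  have J: "countable J" unfolding J_def by (rule countable_jumps) fact
  have "AE x in lborel. \<forall>s\<in>J. \<forall>l. (f \<longlongrightarrow> l) (at_left s) \<longrightarrow> x + l \<notin> D \<longrightarrow>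
      \<not> (\<forall>r. 0 \<le> r \<and> r < s \<longrightarrow> x + f r \<in> D)"
  proof (subst AE_ball_countable[OF J], intro ballI)
    fix s assume "s \<in> J"
    then obtain l where s: "0 < s" and l: "(f \<longlongrightarrow> l) (at_left s)" by (auto simp: J_def)
    define r where "r = (\<lambda>n. s - s / 2 ^ n)"
    have r: "0 \<le> r n" "r n < s" for n using s by (auto simp: r_def field_simps)
    have "r \<longlonglongrightarrow> s - 0" unfolding r_def
      by (intro tendsto_intros LIMSEQ_divide_realpow_zero) simp
    then have "filterlim r (at_left s) sequentially"
      using r by (auto simp: filterlim_at intro!: always_eventually less_imp_neq)
    from filterlim_compose[OF l this] have "(\<lambda>n. f (r n) - l) \<longlonglongrightarrow> 0"
      by (simp add: LIM_zero)
    from null_outside_inside_translates[OF D this]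
    have "{y. y \<notin> D \<and> (\<forall>n. y + (f (r n) - l) \<in> D)} \<in> null_sets (distr lborel borel ((+) l))"
      by (simp add: lborel_distr_plus)
    then have "AE y in distr lborel borel ((+) l). \<not> (y \<notin> D \<and> (\<forall>n. y + (f (r n) - l) \<in> D))"
      by (auto dest: AE_not_in)
    then have "AE x in lborel. \<not> (l + x \<notin> D \<and> (\<forall>n. l + x + (f (r n) - l) \<in> D))"
      by (subst (asm) AE_distr_iff) auto
    then show "AE x in lborel. \<forall>l. (f \<longlongrightarrow> l) (at_left s) \<longrightarrow> x + l \<notin> D \<longrightarrow>
      \<not> (\<forall>r. 0 \<le> r \<and> r < s \<longrightarrow> x + f r \<in> D)"
    proof eventually_elim
      case (elim x)
      show ?case
      proof (intro allI impI notI)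
        fix l' assume l': "(f \<longlongrightarrow> l') (at_left s)" "x + l' \<notin> D" "\<forall>r. 0 \<le> r \<and> r < s \<longrightarrow> x + f r \<in> D"
        have "l' = l" using tendsto_unique[OF _ l'(1) l] by simp
        then show False using elim l' r by (auto simp: algebra_simps)
      qed
    qed
  qed
  then show ?thesis
  proof eventually_elim
    case (elim x)
    show ?case
    proof
      assume "jumps_from_outside D (\<lambda>s. x + f s)"
      then obtain s l where s: "0 < s" and l: "((\<lambda>s. x + f s) \<longlongrightarrow> l) (at_left s)" "l \<noteq> x + f s" "l \<notin> D"
        and D: "\<And>r. 0 \<le> r \<Longrightarrow> r < s \<Longrightarrow> x + f r \<in> D" by (auto simp: jumps_from_outside_def)
      have "(f \<longlongrightarrow> l - x) (at_left s)"
        using tendsto_diff[OF l(1) tendsto_const[of x]] by simp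
      moreover have "l - x \<noteq> f s" using l(2) by (auto simp: algebra_simps)
      ultimately have "s \<in> J" using s by (auto simp: J_def)
      note \<open>(f \<longlongrightarrow> l - x) (at_left s)\<close>
      with \<open>s \<in> J\<close> show False using elim l(3) D by force
    qed
  qed
qed

section \<open>The martingale behind the killing correction\<close>

context stable_density
begin

lemma rel_kernel_le_origin:
  fixes x :: "'a::euclidean_space"
  assumes t: "0 < t"
  shows "rel_kernel \<alpha> m \<theta> t x \<le> rel_kernel \<alpha> m \<theta> t (0::'a)"
proof -
  have "gauss_mix t x u \<le> gauss_mix t (0::'a) u" if "0 < u" for u
    unfolding gauss_mix_def using nonneg[OF t, of u] that
    by (intro mult_right_mono mult_left_mono) auto
  then have "(\<integral>\<^sup>+u\<in>{0<..}. ennreal (gauss_mix t x u) \<partial>lborel) \<le> (\<integral>\<^sup>+u\<in>{0<..}. ennreal (gauss_mix t (0::'a) u) \<partial>lborel)"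
    by (intro nn_integral_mono) (auto simp: indicator_def intro!: ennreal_leI)
  then show ?thesis
    unfolding rel_kernel_nn_integral[OF t] using rel_kernel_origin(1)[OF t, where ?'a = 'a]
    by (intro mult_left_mono enn2real_mono) auto
qed

text \<open>The kernel is continuous on the open set of positive times and arbitrary positions.\<close>

lemma rel_kernel_jointly_measurable:
  "(\<lambda>(r, z). if 0 < r then rel_kernel \<alpha> m \<theta> r (z::'a::euclidean_space) else 0) \<in> borel_measurable borel"
proof -
  let ?A = "{0<..} \<times> (UNIV :: 'a set)"
  have "continuous_on ?A (\<lambda>p. rel_kernel \<alpha> m \<theta> (fst p) (snd p))"
    by (rule continuous_on_sequentiallyI, rule tendsto_rel_kernel) (auto intro: tendsto_fst tendsto_snd)
  then have "(\<lambda>p. if p \<in> ?A then rel_kernel \<alpha> m \<theta> (fst p) (snd p) else 0) \<in> borel_measurable borel"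
    by (intro borel_measurable_continuous_on_if continuous_on_const borel_open open_Times) auto
  also have "(\<lambda>p. if p \<in> ?A then rel_kernel \<alpha> m \<theta> (fst p) (snd p) else 0)
      = (\<lambda>(r, z). if 0 < r then rel_kernel \<alpha> m \<theta> r z else 0)"
    by auto
  finally show ?thesis .
qed

end

context relativistic_stable_process
begin

lemma characteristic_increment:
  assumes "0 \<le> s" "0 \<le> h"
  shows "expectation (\<lambda>\<omega>. iexp (\<xi> \<bullet> (X (s + h) \<omega> - X s \<omega>))) = complex_of_real (exp (- h * characteristic_exponent \<alpha> m \<xi>))"
proof -
  have [measurable]: "X (s + h) \<in> borel_measurable M" "X s \<in> borel_measurable M" "X h \<in> borel_measurable M"
    using assms by (auto intro: random_variable_X)
  have "expectation (\<lambda>\<omega>. iexp (\<xi> \<bullet> (X (s + h) \<omega> - X s \<omega>)))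
      = (LINT z|distr M borel (\<lambda>\<omega>. X (s + h) \<omega> - X s \<omega>). iexp (\<xi> \<bullet> z))"
    by (subst integral_distr) auto
  also have "\<dots> = (LINT z|distr M borel (X h). iexp (\<xi> \<bullet> z))"
    using stationary_increments[OF assms] by simp
  also have "\<dots> = expectation (\<lambda>\<omega>. iexp (\<xi> \<bullet> X h \<omega>))"
    by (subst integral_distr) auto
  also have "\<dots> = complex_of_real (exp (- h * characteristic_exponent \<alpha> m \<xi>))"
    using characteristic_function[OF assms(2), of \<xi>] by (simp add: characteristic_exponent_def)
  finally show ?thesis .
qed

abbreviation (input) skeleton :: "real \<Rightarrow> nat \<Rightarrow> 'w \<Rightarrow> 'a" where
  "skeleton h i \<omega> \<equiv> X (real i * h) \<omega> - X 0 \<omega>"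

text \<open>The next increment of the process sampled at multiples of \<open>h\<close> is independent of the earlier positions,
hence of the event that they avoid \<open>G\<close>.\<close>

lemma skeleton_step:
  fixes j :: nat
  assumes h: "0 \<le> h" and G[measurable]: "G \<in> sets borel"
  defines "B \<equiv> {\<omega> \<in> space M. \<forall>i\<le>j. skeleton h i \<omega> \<notin> G}"
  shows "expectation (\<lambda>\<omega>. complex_of_real (indicator B \<omega>) * iexp (\<xi> \<bullet> skeleton h (Suc j) \<omega>))
    = expectation (\<lambda>\<omega>. complex_of_real (indicator B \<omega>) * iexp (\<xi> \<bullet> skeleton h j \<omega>)) * complex_of_real (exp (- h * characteristic_exponent \<alpha> m \<xi>))"
proof -
  define \<Delta> where "\<Delta> = (\<lambda>i \<omega>. X (real (Suc i) * h) \<omega> - X (real i * h) \<omega>)"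
  have rv[measurable]: "X (real i * h) \<in> borel_measurable M" for i
    using h by (intro random_variable_X) auto
  have rv0[measurable]: "X 0 \<in> borel_measurable M" by (intro random_variable_X) auto
  have indep: "indep_vars (\<lambda>_. borel) \<Delta> {..<Suc j}"
    unfolding \<Delta>_def by (rule independent_increments[where s = "\<lambda>i. real i * h"]) (use h in \<open>auto intro!: mult_right_mono\<close>)
  have tele: "skeleton h i \<omega> = (\<Sum>k<i. \<Delta> k \<omega>)" for i \<omega>
    unfolding \<Delta>_def by (subst sum_lessThan_telescope) simp
  define u where "u = (\<lambda>\<delta>::nat \<Rightarrow> 'a. (if \<forall>i\<le>j. (\<Sum>k<i. \<delta> k) \<notin> G then 1 else 0) * iexp (\<xi> \<bullet> (\<Sum>k<j. \<delta> k)))"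
  have [measurable]: "(\<lambda>\<delta>. \<Sum>k<i. \<delta> k) \<in> borel_measurable (PiM {..<j} (\<lambda>_. borel :: 'a measure))" if "i \<le> j" for i
    using that by (intro borel_measurable_sum measurable_component_singleton) auto
  have um: "u \<in> borel_measurable (PiM {..<j} (\<lambda>_. borel))"
  proof -
    have "{\<delta> \<in> space (PiM {..<j} (\<lambda>_. borel)). \<forall>i\<in>{..j}. (\<Sum>k<i. \<delta> k :: 'a) \<notin> G} \<in> sets (PiM {..<j} (\<lambda>_. borel))"
      by (intro sets.sets_Collect_finite_All') auto
    then show ?thesis
      unfolding u_def by (intro borel_measurable_times measurable_If) (auto simp: Ball_def)
  qed
  have "indep_var (PiM {..<j} (\<lambda>_. borel)) (\<lambda>\<omega>. restrict (\<lambda>i. \<Delta> i \<omega>) {..<j}) (PiM {j} (\<lambda>_. borel)) (\<lambda>\<omega>. restrict (\<lambda>i. \<Delta> i \<omega>) {j})"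
    by (rule indep_var_restrict[OF indep]) auto
  then have "indep_var borel (u \<circ> (\<lambda>\<omega>. restrict (\<lambda>i. \<Delta> i \<omega>) {..<j})) borel ((\<lambda>\<delta>. iexp (\<xi> \<bullet> \<delta> j)) \<circ> (\<lambda>\<omega>. restrict (\<lambda>i. \<Delta> i \<omega>) {j}))"
    by (rule indep_var_compose[OF _ um]) measurable
  moreover have "(u \<circ> (\<lambda>\<omega>. restrict (\<lambda>i. \<Delta> i \<omega>) {..<j})) = (\<lambda>\<omega>. (if \<forall>i\<le>j. skeleton h i \<omega> \<notin> G then 1 else 0) * iexp (\<xi> \<bullet> skeleton h j \<omega>))"
  proof -
    have "(\<Sum>k<i. restrict (\<lambda>i. \<Delta> i \<omega>) {..<j} k) = (\<Sum>k<i. \<Delta> k \<omega>)" if "i \<le> j" for i \<omega>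
      using that by (intro sum.cong) auto
    then show ?thesis unfolding tele by (auto simp: u_def fun_eq_iff)
  qed
  moreover have "(\<lambda>\<delta>. iexp (\<xi> \<bullet> \<delta> j)) \<circ> (\<lambda>\<omega>. restrict (\<lambda>i. \<Delta> i \<omega>) {j}) = (\<lambda>\<omega>. iexp (\<xi> \<bullet> \<Delta> j \<omega>))"
    by (auto simp: fun_eq_iff)
  ultimately have iv: "indep_var borel (\<lambda>\<omega>. (if \<forall>i\<le>j. skeleton h i \<omega> \<notin> G then 1 else 0) * iexp (\<xi> \<bullet> skeleton h j \<omega>))
      borel (\<lambda>\<omega>. iexp (\<xi> \<bullet> \<Delta> j \<omega>))" by (simp only:)
  have m1: "(\<lambda>\<omega>. (if \<forall>i\<le>j. skeleton h i \<omega> \<notin> G then 1 else 0) * iexp (\<xi> \<bullet> skeleton h j \<omega>)) \<in> borel_measurable M"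
    using indep_var_rv1[OF iv] .
  have m2: "(\<lambda>\<omega>. iexp (\<xi> \<bullet> \<Delta> j \<omega>)) \<in> borel_measurable M"
    using indep_var_rv2[OF iv] .
  have "integrable M (\<lambda>\<omega>. (if \<forall>i\<le>j. skeleton h i \<omega> \<notin> G then 1 else 0) * iexp (\<xi> \<bullet> skeleton h j \<omega>))"
    by (rule integrable_const_bound[where B = 1, OF _ m1]) (auto simp: norm_mult)
  moreover have "integrable M (\<lambda>\<omega>. iexp (\<xi> \<bullet> \<Delta> j \<omega>))"
    by (rule integrable_const_bound[where B = 1, OF _ m2]) auto
  ultimately have "expectation (\<lambda>\<omega>. ((if \<forall>i\<le>j. skeleton h i \<omega> \<notin> G then 1 else 0) * iexp (\<xi> \<bullet> skeleton h j \<omega>)) * iexp (\<xi> \<bullet> \<Delta> j \<omega>))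
     = expectation (\<lambda>\<omega>. (if \<forall>i\<le>j. skeleton h i \<omega> \<notin> G then 1 else 0) * iexp (\<xi> \<bullet> skeleton h j \<omega>)) * expectation (\<lambda>\<omega>. iexp (\<xi> \<bullet> \<Delta> j \<omega>))"
    by (rule indep_var_lebesgue_integral[OF iv])
  moreover have "expectation (\<lambda>\<omega>. iexp (\<xi> \<bullet> \<Delta> j \<omega>)) = complex_of_real (exp (- h * characteristic_exponent \<alpha> m \<xi>))"
    using characteristic_increment[of "real j * h" h \<xi>] h by (simp add: \<Delta>_def algebra_simps)
  moreover have "iexp (\<xi> \<bullet> skeleton h (Suc j) \<omega>) = iexp (\<xi> \<bullet> skeleton h j \<omega>) * iexp (\<xi> \<bullet> \<Delta> j \<omega>)" for \<omega>
    by (simp add: \<Delta>_def inner_diff_right algebra_simps flip: exp_add)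
  moreover have "expectation (\<lambda>\<omega>. (if \<forall>i\<le>j. skeleton h i \<omega> \<notin> G then 1 else 0) * z \<omega>) = expectation (\<lambda>\<omega>. complex_of_real (indicator B \<omega>) * z \<omega>)" for z
    by (intro Bochner_Integration.integral_cong) (auto simp: B_def)
  ultimately show ?thesis by (simp add: mult.assoc)
qed

end

locale relativistic_stable_density_process =
  relativistic_stable_process M X \<alpha> m + stable_density \<alpha> m \<theta>
  for M :: "'w measure" and X :: "real \<Rightarrow> 'w \<Rightarrow> 'a::euclidean_space" and \<alpha> m \<theta>
begin

lemma expectation_kernel_fourier:
  assumes r: "0 < r" and V[measurable]: "V \<in> borel_measurable M" and B[measurable]: "B \<in> sets M"
  shows "complex_of_real (expectation (\<lambda>\<omega>. indicator B \<omega> * rel_kernel \<alpha> m \<theta> r (V \<omega> :: 'a)))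
    = complex_of_real (1 / (2 * pi) ^ DIM('a)) *
      (LINT \<xi>|lborel. expectation (\<lambda>\<omega>. complex_of_real (indicator B \<omega>) * iexp (\<xi> \<bullet> V \<omega>)) * complex_of_real (exp (- r * characteristic_exponent \<alpha> m \<xi>)))"
proof -
  interpret pair: pair_sigma_finite M "lborel :: 'a measure" ..
  let ?e = "\<lambda>\<xi>::'a. exp (- r * characteristic_exponent \<alpha> m \<xi>)"
  let ?K = "complex_of_real (1 / (2 * pi) ^ DIM('a))"
  note e_int = rel_kernel_fourier(1)[OF r, where ?'a = 'a]
  define F where "F = (\<lambda>\<omega> (\<xi>::'a). complex_of_real (indicator B \<omega>) * iexp (\<xi> \<bullet> V \<omega>) * complex_of_real (?e \<xi>))"
  have em[measurable]: "characteristic_exponent \<alpha> m \<in> borel_measurable (borel :: 'a measure)"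
    unfolding characteristic_exponent_def by measurable
  have nF: "norm (F \<omega> \<xi>) = indicator B \<omega> * ?e \<xi>" for \<omega> \<xi>
    by (simp add: F_def norm_mult)
  have F_int: "integrable lborel (F \<omega>)" for \<omega>
  proof (rule Bochner_Integration.integrable_bound[OF e_int])
    show "F \<omega> \<in> borel_measurable lborel" unfolding F_def by measurable
    show "AE \<xi> in lborel. norm (F \<omega> \<xi>) \<le> norm (?e \<xi>)"
      by (rule AE_I2) (simp add: nF indicator_def)
  qed
  have FF: "integrable (M \<Otimes>\<^sub>M lborel) (case_prod F)"
  proof (rule pair.Fubini_integrable)
    show "case_prod F \<in> borel_measurable (M \<Otimes>\<^sub>M lborel)" unfolding F_def by measurable
    show "integrable M (\<lambda>\<omega>. LINT \<xi>|lborel. norm (case (\<omega>, \<xi>) of (a, b) \<Rightarrow> F a b))"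
      by (simp add: nF emeasure_eq_measure)
  qed (simp add: F_int)
  have "complex_of_real (indicator B \<omega> * rel_kernel \<alpha> m \<theta> r (V \<omega>)) = ?K * (LINT \<xi>|lborel. F \<omega> \<xi>)" for \<omega>
    unfolding F_def mult.assoc of_real_mult[of "indicator B \<omega>"] rel_kernel_fourier(2)[OF r]
    by (simp only: integral_mult_right_zero mult.left_commute)
  then have "complex_of_real (expectation (\<lambda>\<omega>. indicator B \<omega> * rel_kernel \<alpha> m \<theta> r (V \<omega>))) = expectation (\<lambda>\<omega>. ?K * (LINT \<xi>|lborel. F \<omega> \<xi>))"
    by (simp only: integral_complex_of_real[symmetric])
  also have "\<dots> = ?K * expectation (\<lambda>\<omega>. LINT \<xi>|lborel. F \<omega> \<xi>)"
    by (rule integral_mult_right_zero)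
  also have "expectation (\<lambda>\<omega>. LINT \<xi>|lborel. F \<omega> \<xi>) = (LINT \<xi>|lborel. expectation (\<lambda>\<omega>. F \<omega> \<xi>))"
    by (rule pair.Fubini_integral[OF FF, symmetric])
  also have "\<dots> = (LINT \<xi>|lborel. expectation (\<lambda>\<omega>. complex_of_real (indicator B \<omega>) * iexp (\<xi> \<bullet> V \<omega>)) * complex_of_real (?e \<xi>))"
    unfolding F_def by (simp only: integral_mult_left_zero)
  finally show ?thesis .
qed

text \<open>On the Fourier side, one step of the process contributes the factor \<open>exp (- h * \<psi>)\<close> with \<open>\<psi>\<close> the
characteristic exponent, which is what lengthening the remaining time from \<open>r\<close> to \<open>r + h\<close> does.\<close>

lemma kernel_martingale_step:
  fixes j :: nat
  assumes h: "0 \<le> h" and r: "0 < r" and G[measurable]: "G \<in> sets borel"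
  defines "B \<equiv> {\<omega> \<in> space M. \<forall>i\<le>j. skeleton h i \<omega> \<notin> G}"
  shows "expectation (\<lambda>\<omega>. indicator B \<omega> * rel_kernel \<alpha> m \<theta> r (skeleton h (Suc j) \<omega>))
    = expectation (\<lambda>\<omega>. indicator B \<omega> * rel_kernel \<alpha> m \<theta> (r + h) (skeleton h j \<omega>))"
proof -
  have [measurable]: "X (real i * h) \<in> borel_measurable M" "X 0 \<in> borel_measurable M" for i
    using h by (auto intro!: random_variable_X)
  have [measurable]: "B \<in> sets M" unfolding B_def by measurable
  have "exp (- (r + h) * characteristic_exponent \<alpha> m \<xi>) = exp (- h * characteristic_exponent \<alpha> m \<xi>) * exp (- r * characteristic_exponent \<alpha> m \<xi>)" for \<xi> :: 'a
    by (simp add: algebra_simps flip: exp_add)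
  then have "expectation (\<lambda>\<omega>. complex_of_real (indicator B \<omega>) * iexp (\<xi> \<bullet> skeleton h (Suc j) \<omega>)) * complex_of_real (exp (- r * characteristic_exponent \<alpha> m \<xi>))
      = expectation (\<lambda>\<omega>. complex_of_real (indicator B \<omega>) * iexp (\<xi> \<bullet> skeleton h j \<omega>)) * complex_of_real (exp (- (r + h) * characteristic_exponent \<alpha> m \<xi>))" for \<xi>
    unfolding B_def skeleton_step[OF h G] by (simp only: of_real_mult mult.assoc)
  moreover have "complex_of_real (expectation (\<lambda>\<omega>. indicator B \<omega> * rel_kernel \<alpha> m \<theta> r (skeleton h (Suc j) \<omega>)))
      = complex_of_real (1 / (2 * pi) ^ DIM('a)) *
      (LINT \<xi>|lborel. expectation (\<lambda>\<omega>. complex_of_real (indicator B \<omega>) * iexp (\<xi> \<bullet> skeleton h (Suc j) \<omega>)) * complex_of_real (exp (- r * characteristic_exponent \<alpha> m \<xi>)))"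
    by (rule expectation_kernel_fourier[OF r]) measurable
  moreover have "complex_of_real (expectation (\<lambda>\<omega>. indicator B \<omega> * rel_kernel \<alpha> m \<theta> (r + h) (skeleton h j \<omega>)))
      = complex_of_real (1 / (2 * pi) ^ DIM('a)) *
      (LINT \<xi>|lborel. expectation (\<lambda>\<omega>. complex_of_real (indicator B \<omega>) * iexp (\<xi> \<bullet> skeleton h j \<omega>)) * complex_of_real (exp (- (r + h) * characteristic_exponent \<alpha> m \<xi>)))"
    by (rule expectation_kernel_fourier[OF add_pos_nonneg[OF r h]]) measurable
  ultimately have "complex_of_real (expectation (\<lambda>\<omega>. indicator B \<omega> * rel_kernel \<alpha> m \<theta> r (skeleton h (Suc j) \<omega>)))
      = complex_of_real (expectation (\<lambda>\<omega>. indicator B \<omega> * rel_kernel \<alpha> m \<theta> (r + h) (skeleton h j \<omega>)))"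
    by (simp only:)
  then show ?thesis by (simp only: of_real_eq_iff)
qed

text \<open>Optional stopping: the mass of the martingale is split step by step into the part that has just entered
\<open>G\<close> (the events \<open>A\<close>) and the part that has not entered \<open>G\<close> so far (the events \<open>B\<close>). The total is conserved,
and the part that never enters \<open>G\<close> is nonnegative. The grid ends one step before \<open>t\<close>, since the kernel is
singular at remaining time 0.\<close>

lemma nn_integral_grid_stop_le:
  assumes t: "0 < t" and G[measurable]: "G \<in> sets borel"
  shows "(\<integral>\<^sup>+\<omega>. ennreal (grid_stop t n G (rel_kernel \<alpha> m \<theta>) (\<lambda>s. X s \<omega> - X 0 \<omega>)) \<partial>M) \<le> ennreal (rel_kernel \<alpha> m \<theta> t (0::'a))"
proof -
  define h where "h = t / 2 ^ n"
  have h: "0 < h" using t by (simp add: h_def)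
  have t_h: "t - real i * h = t - real (Suc i) * h + h" for i by (simp add: algebra_simps)
  have pos: "0 < t - real i * h" if "i < 2 ^ n" for i
  proof -
    have "real i < real (2 ^ n)" using that by (simp only: of_nat_less_iff)
    then have "real i * h < 2 ^ n * h" using h by simp
    then show ?thesis by (simp add: h_def)
  qed
  have [measurable]: "X (real i * h) \<in> borel_measurable M" "X 0 \<in> borel_measurable M" for i
    using h by (auto intro!: random_variable_X)
  define B where "B = (\<lambda>j. {\<omega> \<in> space M. \<forall>i\<le>j. skeleton h i \<omega> \<notin> G})"
  define A where "A = (\<lambda>j. {\<omega> \<in> space M. skeleton h j \<omega> \<in> G \<and> (\<forall>i<j. skeleton h i \<omega> \<notin> G)})"
  define K where "K = (\<lambda>j \<omega>. rel_kernel \<alpha> m \<theta> (t - real j * h) (skeleton h j \<omega>))"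
  have [measurable]: "A j \<in> sets M" "B j \<in> sets M" for j unfolding A_def B_def by measurable
  have K_meas: "K j \<in> borel_measurable M" if "j < 2 ^ n" for j
    unfolding K_def using rel_kernel_measurable[OF pos[OF that]] by measurable
  have K_nonneg: "0 \<le> K j \<omega>" if "j < 2 ^ n" for j \<omega>
    unfolding K_def by (rule rel_kernel_nonneg[OF pos[OF that]])
  have int: "integrable M (\<lambda>\<omega>. indicator S \<omega> * K j \<omega>)" if j: "j < 2 ^ n" and [measurable]: "S \<in> sets M" for S j
  proof (rule integrable_const_bound[where B = "rel_kernel \<alpha> m \<theta> (t - real j * h) (0::'a)"])
    show "AE \<omega> in M. norm (indicator S \<omega> * K j \<omega>) \<le> rel_kernel \<alpha> m \<theta> (t - real j * h) (0::'a)"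
      by (intro AE_I2) (simp add: K_def indicator_def rel_kernel_le_origin[OF pos[OF j]] rel_kernel_nonneg[OF pos[OF j]])
    show "(\<lambda>\<omega>. indicator S \<omega> * K j \<omega>) \<in> borel_measurable M" using K_meas[OF j] by measurable
  qed
  have split: "expectation (\<lambda>\<omega>. indicator S \<omega> * K j \<omega>)
      = expectation (\<lambda>\<omega>. indicator (A j) \<omega> * K j \<omega>) + expectation (\<lambda>\<omega>. indicator (B j) \<omega> * K j \<omega>)"
    if j: "j < 2 ^ n" and S: "S = {\<omega> \<in> space M. \<forall>i<j. skeleton h i \<omega> \<notin> G}" for S j
  proof -
    have "indicator S \<omega> * K j \<omega> = indicator (A j) \<omega> * K j \<omega> + indicator (B j) \<omega> * K j \<omega>" for \<omega>
      by (auto simp: S A_def B_def indicator_def le_less)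
    then show ?thesis using int[OF j] by (simp add: Bochner_Integration.integral_add)
  qed
  have main: "(\<Sum>i\<le>j. expectation (\<lambda>\<omega>. indicator (A i) \<omega> * K i \<omega>)) + expectation (\<lambda>\<omega>. indicator (B j) \<omega> * K j \<omega>) = rel_kernel \<alpha> m \<theta> t (0::'a)"
    if "j < 2 ^ n" for j
    using that
  proof (induction j)
    case 0
    have "expectation (\<lambda>\<omega>. indicator (space M) \<omega> * K 0 \<omega>) = expectation (\<lambda>\<omega>. rel_kernel \<alpha> m \<theta> t (0::'a))"
      by (intro Bochner_Integration.integral_cong) (auto simp: K_def)
    then show ?case using split[of 0 "space M"] by (simp add: prob_space)
  next
    case (Suc j)
    have "expectation (\<lambda>\<omega>. indicator (B j) \<omega> * K j \<omega>) = expectation (\<lambda>\<omega>. indicator (B j) \<omega> * K (Suc j) \<omega>)"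
      unfolding K_def B_def t_h[of j] using h
      by (intro kernel_martingale_step[symmetric] pos Suc.prems) auto
    also have "\<dots> = expectation (\<lambda>\<omega>. indicator (A (Suc j)) \<omega> * K (Suc j) \<omega>) + expectation (\<lambda>\<omega>. indicator (B (Suc j)) \<omega> * K (Suc j) \<omega>)"
      by (rule split[OF Suc.prems]) (auto simp: B_def less_Suc_eq_le)
    finally show ?case using Suc by simp
  qed
  obtain N where N: "2 ^ n = Suc N" using gr0_implies_Suc[of "2 ^ n"] by auto
  let ?S = "\<lambda>\<omega>. \<Sum>i\<le>N. indicator (A i) \<omega> * K i \<omega>"
  have "(\<integral>\<^sup>+\<omega>. ennreal (grid_stop t n G (rel_kernel \<alpha> m \<theta>) (\<lambda>s. X s \<omega> - X 0 \<omega>)) \<partial>M) = (\<integral>\<^sup>+\<omega>. ennreal (?S \<omega>) \<partial>M)"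
    unfolding grid_stop_def Let_def h_def[symmetric] N lessThan_Suc_atMost
    by (intro nn_integral_cong arg_cong[of _ _ ennreal] sum.cong) (auto simp: A_def K_def indicator_def)
  also have "\<dots> = ennreal (expectation ?S)"
    using N by (intro nn_integral_eq_integral Bochner_Integration.integrable_sum int AE_I2 sum_nonneg mult_nonneg_nonneg K_nonneg) auto
  also have "expectation ?S = (\<Sum>i\<le>N. expectation (\<lambda>\<omega>. indicator (A i) \<omega> * K i \<omega>))"
    using N by (intro Bochner_Integration.integral_sum int) auto
  also have "\<dots> \<le> rel_kernel \<alpha> m \<theta> t (0::'a)"
  proof -
    have "0 \<le> expectation (\<lambda>\<omega>. indicator (B N) \<omega> * K N \<omega>)"
      using K_nonneg[of N] N by (intro integral_nonneg_AE AE_I2 mult_nonneg_nonneg) auto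
    then show ?thesis using main[of N] N by simp
  qed
  finally show ?thesis by (simp add: ennreal_leI)
qed

end

section \<open>Joint measurability of paths and hitting times\<close>

text \<open>The path is evaluated at multiples of \<open>1 / (k + 1)\<close> just above \<open>T\<close>, which take countably many values;
right-continuity gives the limit.\<close>

lemma cadlag_jointly_measurable:
  fixes Y :: "real \<Rightarrow> 'w \<Rightarrow> 'a::{metric_space, second_countable_topology}"
  assumes Y: "\<And>s. 0 \<le> s \<Longrightarrow> Y s \<in> borel_measurable M" "\<And>\<omega>. \<omega> \<in> space M \<Longrightarrow> cadlag (\<lambda>s. Y s \<omega>)"
    and T[measurable]: "T \<in> borel_measurable N" "\<And>p. p \<in> space N \<Longrightarrow> 0 \<le> T p"
    and W[measurable]: "W \<in> measurable N M"
  shows "(\<lambda>p. Y (T p) (W p)) \<in> borel_measurable N"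
proof (rule borel_measurable_LIMSEQ_metric)
  define r where "r = (\<lambda>k p. real (nat \<lfloor>real (Suc k) * T p\<rfloor> + 1) / real (Suc k))"
  fix k
  show "(\<lambda>p. Y (r k p) (W p)) \<in> borel_measurable N"
    unfolding r_def
  proof (rule measurable_compose_countable[where g = "\<lambda>p. nat \<lfloor>real (Suc k) * T p\<rfloor>"])
    show "(\<lambda>p. Y (real (i + 1) / real (Suc k)) (W p)) \<in> borel_measurable N" for i
      by (rule measurable_compose[OF W Y(1)]) simp
    show "(\<lambda>p. nat \<lfloor>real (Suc k) * T p\<rfloor>) \<in> measurable N (count_space UNIV)"
      by measurable
  qed
next
  define r where "r = (\<lambda>k p. real (nat \<lfloor>real (Suc k) * T p\<rfloor> + 1) / real (Suc k))"
  fix p assume p: "p \<in> space N"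
  have r: "T p \<le> r k p" "r k p \<le> T p + inverse (real (Suc k))" for k
  proof -
    have "0 \<le> real (Suc k) * T p" using T(2)[OF p] by simp
    then have "real (nat \<lfloor>real (Suc k) * T p\<rfloor>) = of_int \<lfloor>real (Suc k) * T p\<rfloor>" by simp
    then have *: "real (Suc k) * T p \<le> real (nat \<lfloor>real (Suc k) * T p\<rfloor> + 1)"
       "real (nat \<lfloor>real (Suc k) * T p\<rfloor> + 1) \<le> real (Suc k) * T p + 1"
      using real_of_int_floor_add_one_ge[of "real (Suc k) * T p"] of_int_floor_le[of "real (Suc k) * T p"]
      unfolding of_nat_add by linarith+
    show "T p \<le> r k p" using *(1) unfolding r_def by (simp add: pos_le_divide_eq mult.commute del: of_nat_Suc)
    show "r k p \<le> T p + inverse (real (Suc k))"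
      using *(2) unfolding r_def by (simp add: pos_divide_le_eq distrib_left mult.commute del: of_nat_Suc)
  qed
  have "(\<lambda>k. T p + inverse (real (Suc k))) \<longlonglongrightarrow> T p + 0"
    by (intro tendsto_intros LIMSEQ_inverse_real_of_nat)
  then have "(\<lambda>k. r k p) \<longlonglongrightarrow> T p"
    unfolding add_0_right by (rule tendsto_sandwich[OF _ _ tendsto_const, rotated 2]) (simp_all add: r del: of_nat_Suc)
  then show "(\<lambda>k. Y (r k p) (W p)) \<longlonglongrightarrow> Y (T p) (W p)"
    by (rule cadlag_tendsto_from_right[OF Y(2)[OF measurable_space[OF W p]] T(2)[OF p]])
       (rule always_eventually, simp add: r)
qed

text \<open>A right-continuous path that hits an open set is in it at some rational time soon after. This expresses hitting
times through countably many positions and makes them measurable.\<close>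

lemma hit_before_less_iff_rational:
  fixes f :: "real \<Rightarrow> 'a::metric_space"
  assumes f: "cadlag f" and G: "open G" and t: "0 < t" "a \<le> t"
  shows "hit_before t G f < a \<longleftrightarrow> (\<exists>q\<in>{q\<in>\<rat>. 0 \<le> q \<and> q < a}. f q \<in> G)"
proof
  assume "hit_before t G f < a"
  then obtain s where s: "0 \<le> s" "s < a" "f s \<in> G"
    using hit_before_less_iff[OF t] by auto
  obtain \<eta> where \<eta>: "0 < \<eta>" "\<And>r. s \<le> r \<Longrightarrow> r < s + \<eta> \<Longrightarrow> f r \<in> G"
    using cadlag_stays_in_open[OF f s(1) G s(3)] by blast
  have "s < min a (s + \<eta>)" using s \<eta> by simp
  from Rats_dense_in_real[OF this] obtain q where q: "q \<in> \<rat>" "s < q" "q < min a (s + \<eta>)"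
    by auto
  with s \<eta>(2)[of q] show "\<exists>q\<in>{q\<in>\<rat>. 0 \<le> q \<and> q < a}. f q \<in> G"
    by (intro bexI[of _ q]) auto
next
  assume "\<exists>q\<in>{q\<in>\<rat>. 0 \<le> q \<and> q < a}. f q \<in> G"
  then show "hit_before t G f < a" using hit_before_less_iff[OF t] by auto
qed

lemma hit_before_measurable:
  fixes Z :: "real \<Rightarrow> 'b \<Rightarrow> 'a::metric_space"
  assumes Z: "\<And>s. 0 \<le> s \<Longrightarrow> Z s \<in> borel_measurable N" "\<And>p. p \<in> space N \<Longrightarrow> cadlag (\<lambda>s. Z s p)"
    and G: "open G" and t: "0 < t"
  shows "(\<lambda>p. hit_before t G (\<lambda>s. Z s p)) \<in> borel_measurable N"
proof (rule borel_measurableI_less)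
  fix a
  have Gb[measurable]: "G \<in> sets borel" using G by simp
  show "{p \<in> space N. hit_before t G (\<lambda>s. Z s p) < a} \<in> sets N"
  proof (cases "a \<le> t")
    case True
    have "countable {q\<in>\<rat>. 0 \<le> q \<and> q < a}"
      by (rule countable_subset[OF _ countable_rat]) auto
    then have "(\<Union>q\<in>{q\<in>\<rat>. 0 \<le> q \<and> q < a}. {p \<in> space N. Z q p \<in> G}) \<in> sets N"
    proof (rule sets.countable_UN'')
      fix q assume "q \<in> {q\<in>\<rat>. 0 \<le> q \<and> q < a}"
      then have [measurable]: "Z q \<in> borel_measurable N" using Z(1) by auto
      show "{p \<in> space N. Z q p \<in> G} \<in> sets N" by measurable
    qed
    also have "(\<Union>q\<in>{q\<in>\<rat>. 0 \<le> q \<and> q < a}. {p \<in> space N. Z q p \<in> G}) = {p \<in> space N. hit_before t G (\<lambda>s. Z s p) < a}"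
      using hit_before_less_iff_rational[OF Z(2) G t True] by blast
    finally show ?thesis .
  next
    case False
    then have "{p \<in> space N. hit_before t G (\<lambda>s. Z s p) < a} = space N"
      using le_less_trans[OF hit_before_bounds(2)[OF t], of a G] by auto
    then show ?thesis by simp
  qed
qed

lemma borel_measurable_completion_cong_AE:
  fixes f g :: "'b \<Rightarrow> 'c::topological_space"
  assumes g: "g \<in> borel_measurable M" and eq: "AE x in completion M. f x = g x"
  shows "f \<in> borel_measurable (completion M)"
proof (rule measurableI)
  fix A :: "'c set" assume A: "A \<in> sets borel"
  show "f -` A \<inter> space (completion M) \<in> sets (completion M)"
  proof (rule completion.in_sets_AE)
    show "AE x in completion M. x \<in> g -` A \<inter> space (completion M) \<longleftrightarrow> x \<in> f -` A \<inter> space (completion M)"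
      using eq by eventually_elim auto
    show "g -` A \<inter> space (completion M) \<in> sets (completion M)"
      using measurable_sets[OF measurable_completion[OF g] A] .
  qed auto
qed simp

section \<open>The killing correction on the diagonal\<close>

context relativistic_stable_density_process
begin

text \<open>The integrand of the correction is compared with the jointly measurable function \<open>F\<close> in which the exit time
is replaced by the limit \<open>\<sigma>\<close> of the hitting times of the collars. The two agree unless the path from \<open>x\<close> is
exceptional; this is excluded for almost every pair of starting point and path. Fatou's lemma along
the collars and, for each of them, along the grids bounds the integral of \<open>F\<close>.\<close>

lemma killed_correction_diagonal:
  assumes t: "0 < t" and D: "open D" "emeasure lborel D < \<infinity>"
  obtains R :: "'a \<Rightarrow> real" where "R \<in> borel_measurable borel"
    and "AE x in lborel. killed_correction M X \<alpha> m \<theta> D t x x = R x \<and> R x \<le> rel_kernel \<alpha> m \<theta> t (0::'a)"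
proof -
  interpret pair: pair_sigma_finite "lborel :: 'a measure" M ..
  let ?P = "rel_kernel \<alpha> m \<theta> :: real \<Rightarrow> 'a \<Rightarrow> real"
  let ?N = "(lborel :: 'a measure) \<Otimes>\<^sub>M M"
  have Db[measurable]: "D \<in> sets borel" using D by simp
  have "AE \<omega> in M. cadlag (\<lambda>s. X s \<omega>) \<and> X 0 \<omega> = 0"
    using cadlag_paths start_at_zero by eventually_elim auto
  then obtain E where E: "{\<omega> \<in> space M. \<not> (cadlag (\<lambda>s. X s \<omega>) \<and> X 0 \<omega> = 0)} \<subseteq> E" "emeasure M E = 0" "E \<in> sets M"
    by (rule AE_E)
  note E(3)[measurable]
  have AE_notin_E: "AE \<omega> in M. \<omega> \<notin> E" using E by (intro AE_not_in null_setsI)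
  \<comment> \<open>A version of the process all of whose paths are regular; its paths agree with those of \<open>X\<close> outside \<open>E\<close>.\<close>
  define Y where "Y = (\<lambda>s \<omega>. if \<omega> \<in> E then 0 else X s \<omega>)"
  have Ym: "Y s \<in> borel_measurable M" if "0 \<le> s" for s
  proof -
    have [measurable]: "X s \<in> borel_measurable M" using that by (rule random_variable_X)
    show ?thesis unfolding Y_def by measurable
  qed
  have Yc: "cadlag (\<lambda>s. Y s \<omega>)" if "\<omega> \<in> space M" for \<omega>
  proof (cases "\<omega> \<in> E")
    case True
    then show ?thesis by (auto simp: Y_def cadlag_def)
  next
    case False
    then have "cadlag (\<lambda>s. X s \<omega>)" using that E(1) by auto
    then show ?thesis using False by (simp add: Y_def)
  qed
  define Z where "Z = (\<lambda>s (p :: 'a \<times> 'w). fst p + Y s (snd p))"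
  have Zm: "Z s \<in> borel_measurable ?N" if "0 \<le> s" for s
    using Ym[OF that] unfolding Z_def by measurable
  have Zc: "cadlag (\<lambda>s. Z s p)" if "p \<in> space ?N" for p
  proof -
    have "cadlag (\<lambda>s. Y s (snd p))" using that by (intro Yc) (auto simp: space_pair_measure)
    then show ?thesis unfolding Z_def by (rule cadlag_translate)
  qed
  define \<tau> where "\<tau> = (\<lambda>k p. collar_hit t D (\<lambda>s. Z s p) k)"
  define \<sigma> where "\<sigma> = (\<lambda>p. collar_hit_lim t D (\<lambda>s. Z s p))"
  have \<tau>_nonneg: "0 \<le> \<tau> k p" for k p
    unfolding \<tau>_def collar_hit_def by (rule hit_before_bounds(1)[OF t])
  have \<tau>_lim: "(\<lambda>k. \<tau> k p) \<longlonglongrightarrow> \<sigma> p" and \<tau>_le: "\<tau> k p \<le> \<sigma> p" if "p \<in> space ?N" for k p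
    unfolding \<tau>_def \<sigma>_def using collar_hit_limit(1,2)[OF Zc[OF that] D(1) t] by auto
  have \<tau>m[measurable]: "\<tau> k \<in> borel_measurable ?N" for k
    unfolding \<tau>_def collar_hit_def using hit_before_measurable[OF Zm Zc open_collar t] by simp
  have \<sigma>m[measurable]: "\<sigma> \<in> borel_measurable ?N"
    by (rule borel_measurable_LIMSEQ_real[OF \<tau>_lim \<tau>m])
  have \<sigma>_nonneg: "0 \<le> \<sigma> p" if "p \<in> space ?N" for p
    using \<tau>_nonneg[of 0 p] \<tau>_le[OF that, of 0] by simp
  have [measurable]: "(\<lambda>p. Z (\<tau> k p) p) \<in> borel_measurable ?N" for k
    using cadlag_jointly_measurable[OF Zm Zc \<tau>m \<tau>_nonneg measurable_ident_sets[OF refl]] by simp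
  have [measurable]: "(\<lambda>p. Z (\<sigma> p) p) \<in> borel_measurable ?N"
    using cadlag_jointly_measurable[OF Zm Zc \<sigma>m \<sigma>_nonneg measurable_ident_sets[OF refl]] by simp
  \<comment> \<open>A measurable set of pairs that contains all pairs for which \<open>\<sigma>\<close> differs from the exit time capped at \<open>t\<close>.\<close>
  define bad where "bad = (\<lambda>x \<omega>. \<sigma> (x, \<omega>) < t \<and> \<not> (\<lambda>k. Z (\<tau> k (x, \<omega>)) (x, \<omega>)) \<longlonglongrightarrow> Z (\<sigma> (x, \<omega>)) (x, \<omega>))"
  \<comment> \<open>Convergence in terms of countably many conditions, so that it defines a measurable set.\<close>
  have lim_iff: "(f \<longlonglongrightarrow> l) \<longleftrightarrow> (\<forall>m. \<exists>n. \<forall>k\<ge>n. dist (f k) l < inverse (real (Suc m)))" for f :: "nat \<Rightarrow> 'a" and l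
  proof
    assume "f \<longlonglongrightarrow> l"
    then show "\<forall>m. \<exists>n. \<forall>k\<ge>n. dist (f k) l < inverse (real (Suc m))"
      by (auto intro!: metric_LIMSEQ_D)
  next
    assume *: "\<forall>m. \<exists>n. \<forall>k\<ge>n. dist (f k) l < inverse (real (Suc m))"
    show "f \<longlonglongrightarrow> l"
    proof (rule metric_LIMSEQ_I)
      fix r :: real assume "0 < r"
      then obtain i where "inverse (real (Suc i)) < r" using reals_Archimedean by blast
      with * show "\<exists>n. \<forall>k\<ge>n. dist (f k) l < r" by (meson less_trans)
    qed
  qed
  have "{p \<in> space ?N. \<not> bad (fst p) (snd p)} \<in> sets ?N"
    unfolding bad_def lim_iff prod.collapse by measurable
  moreover have "AE \<omega> in M. AE x in lborel. \<not> bad x \<omega>"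
  proof (rule AE_I2)
    fix \<omega> assume \<omega>: "\<omega> \<in> space M"
    from AE_not_jumps_from_outside[OF Yc[OF this] D]
    show "AE x in lborel. \<not> bad x \<omega>"
    proof eventually_elim
      case (elim x)
      have "(x, \<omega>) \<in> space ?N" using \<omega> by (simp add: space_pair_measure)
      from not_tendsto_imp_jumps_from_outside[OF Zc[OF this] D(1) t] elim
      show ?case by (auto simp: bad_def \<tau>_def \<sigma>_def Z_def)
    qed
  qed
  ultimately have good: "AE x in lborel. AE \<omega> in M. \<not> bad x \<omega>"
    by (subst pair.AE_commute)
  define F where "F = (\<lambda>p. if \<sigma> p < t then ?P (t - \<sigma> p) (Z (\<sigma> p) p - fst p) else 0)"
  have Fm: "F \<in> borel_measurable ?N"
  proof -
    have "F = (\<lambda>p. if \<sigma> p < t then (\<lambda>(r, z). if 0 < r then ?P r z else 0) (t - \<sigma> p, Z (\<sigma> p) p - fst p) else 0)"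
      by (auto simp: F_def fun_eq_iff)
    also have "\<dots> \<in> borel_measurable ?N"
    proof (intro measurable_If measurable_compose[OF _ rel_kernel_jointly_measurable])
      show "(\<lambda>p. (t - \<sigma> p, Z (\<sigma> p) p - fst p)) \<in> measurable ?N borel"
        unfolding borel_prod[symmetric] by measurable
    qed measurable
    finally show ?thesis .
  qed
  have F_nonneg: "0 \<le> F p" for p
    by (auto simp: F_def intro!: rel_kernel_nonneg)
  define R where "R = (\<lambda>x. LINT \<omega>|M. F (x, \<omega>))"
  have Rm: "R \<in> borel_measurable borel"
  proof -
    have "R \<in> borel_measurable lborel"
      unfolding R_def by (rule borel_measurable_lebesgue_integral) (use Fm in simp)
    then show ?thesis by simp
  qed
  have Fx: "(\<lambda>\<omega>. F (x, \<omega>)) \<in> borel_measurable M" for x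
    using Fm by measurable
  have eq: "killed_correction M X \<alpha> m \<theta> D t x x = R x" if "AE \<omega> in M. \<not> bad x \<omega>" for x
  proof -
    let ?\<tau> = "\<lambda>\<omega>. exit_time D (\<lambda>s. x + X s \<omega>)"
    let ?I = "\<lambda>\<omega>. indicator {\<omega> \<in> space M. ?\<tau> \<omega> < ereal t} \<omega> *\<^sub>R
        ?P (t - real_of_ereal (?\<tau> \<omega>)) (x + X (real_of_ereal (?\<tau> \<omega>)) \<omega> - x)"
    have "AE \<omega> in M. ?I \<omega> = F (x, \<omega>)"
      using that AE_notin_E AE_space
    proof eventually_elim
      case (elim \<omega>)
      let ?p = "(x, \<omega>)"
      have p: "?p \<in> space ?N" using elim by (simp add: space_pair_measure)
      have path: "x + X s \<omega> = Z s ?p" for s using elim by (simp add: Z_def Y_def)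
      show ?case
      proof (cases "\<sigma> ?p < t")
        case True
        then have "(\<lambda>k. Z (\<tau> k ?p) ?p) \<longlonglongrightarrow> Z (\<sigma> ?p) ?p" using elim by (simp add: bad_def)
        then have \<sigma>: "\<sigma> ?p = hit_before t (- D) (\<lambda>s. Z s ?p)"
          using collar_hit_eq_hit[OF Zc[OF p] D(1) t] True unfolding \<tau>_def \<sigma>_def by blast
        then have ex: "?\<tau> \<omega> < ereal t"
          using True hit_before_less_iff[OF t order_refl, of "- D" "\<lambda>s. Z s ?p"]
          by (simp add: exit_time_less_iff path)
        from exit_time_eq_hit_before[OF this t] have "real_of_ereal (?\<tau> \<omega>) = \<sigma> ?p"
          by (simp add: \<sigma> path)
        then show ?thesis using True ex elim by (simp add: F_def path)
      next
        case False
        have "\<sigma> ?p \<le> hit_before t (- D) (\<lambda>s. Z s ?p)"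
          unfolding \<sigma>_def by (rule collar_hit_limit(4)[OF Zc[OF p] D(1) t])
        then have "\<not> ?\<tau> \<omega> < ereal t"
          using False hit_before_less_iff[OF t order_refl, of "- D" "\<lambda>s. Z s ?p"]
          by (simp add: exit_time_less_iff path)
        then show ?thesis using False by (simp add: F_def)
      qed
    qed
    then have *: "AE \<omega> in completion M. ?I \<omega> = F (x, \<omega>)" by (rule AE_completion)
    have "killed_correction M X \<alpha> m \<theta> D t x x = (LINT \<omega>|completion M. ?I \<omega>)"
      by (simp add: killed_correction_def Let_def set_lebesgue_integral_def)
    also have "\<dots> = (LINT \<omega>|completion M. F (x, \<omega>))"
      by (rule integral_cong_AE[OF borel_measurable_completion_cong_AE[OF Fx *] measurable_completion[OF Fx] *])
    also have "\<dots> = R x" unfolding R_def by (rule integral_completion[OF Fx])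
    finally show ?thesis .
  qed
  have le: "R x \<le> ?P t 0" if good: "AE \<omega> in M. \<not> bad x \<omega>" for x
  proof -
    define S where "S = (\<lambda>k n \<omega>. grid_stop t n (collar D k) (\<lambda>r z. ?P r (z - x)) (\<lambda>s. x + Y s \<omega>))"
    have Sm[measurable]: "S k n \<in> borel_measurable M" for k n
    proof -
      define h where "h = t / 2 ^ n"
      have [measurable]: "Y (real i * h) \<in> borel_measurable M" for i
        using t by (intro Ym) (simp add: h_def)
      have [measurable]: "collar D k \<in> sets borel" using open_collar by (rule borel_open)
      show ?thesis
        unfolding S_def grid_stop_def Let_def h_def[symmetric]
      proof (rule borel_measurable_sum)
        fix i assume i: "i \<in> {..<(2::nat) ^ n}"
        have "0 < t - real i * h"
        proof -
          have "real i < real (2 ^ n)" using i by (simp only: of_nat_less_iff lessThan_iff)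
          then show ?thesis using t by (simp add: h_def field_simps)
        qed
        note rel_kernel_measurable[OF this, measurable]
        show "(\<lambda>\<omega>. if x + Y (real i * h) \<omega> \<in> collar D k \<and> (\<forall>j<i. x + Y (real j * h) \<omega> \<notin> collar D k)
            then ?P (t - real i * h) (x + Y (real i * h) \<omega> - x) else 0) \<in> borel_measurable M"
          by measurable
      qed
    qed
    have S_le: "(\<integral>\<^sup>+\<omega>. ennreal (S k n \<omega>) \<partial>M) \<le> ennreal (?P t 0)" for k n
    proof -
      let ?G = "{z. x + z \<in> collar D k}"
      have "open ?G"
        using continuous_open_vimage[OF open_collar[of D k], of "\<lambda>z. x + z"] by (simp add: vimage_def)
      then have G: "?G \<in> sets borel" by simp
      have "(\<integral>\<^sup>+\<omega>. ennreal (S k n \<omega>) \<partial>M) = (\<integral>\<^sup>+\<omega>. ennreal (grid_stop t n ?G ?P (\<lambda>s. X s \<omega> - X 0 \<omega>)) \<partial>M)"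
      proof (rule nn_integral_cong_AE)
        show "AE \<omega> in M. ennreal (S k n \<omega>) = ennreal (grid_stop t n ?G ?P (\<lambda>s. X s \<omega> - X 0 \<omega>))"
          using AE_notin_E AE_space
        proof eventually_elim
          case (elim \<omega>)
          then have "X 0 \<omega> = 0" using E(1) by auto
          then show ?case using elim by (simp add: S_def grid_stop_def Y_def Let_def cong: if_cong)
        qed
      qed
      also have "\<dots> \<le> ennreal (?P t 0)" by (rule nn_integral_grid_stop_le[OF t G])
      finally show ?thesis .
    qed
    have "(\<integral>\<^sup>+\<omega>. ennreal (F (x, \<omega>)) \<partial>M) \<le> (\<integral>\<^sup>+\<omega>. liminf (\<lambda>k. liminf (\<lambda>n. ennreal (S k n \<omega>))) \<partial>M)"
    proof (rule nn_integral_mono_AE)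
      show "AE \<omega> in M. ennreal (F (x, \<omega>)) \<le> liminf (\<lambda>k. liminf (\<lambda>n. ennreal (S k n \<omega>)))"
        using good AE_space
      proof eventually_elim
        case (elim \<omega>)
        let ?p = "(x, \<omega>)"
        have p: "?p \<in> space ?N" using elim by (simp add: space_pair_measure)
        show ?case
        proof (cases "\<sigma> ?p < t")
          case True
          have lim: "(\<lambda>k. Z (\<tau> k ?p) ?p) \<longlonglongrightarrow> Z (\<sigma> ?p) ?p" using True elim by (simp add: bad_def)
          have "(\<lambda>n. S k n \<omega>) \<longlonglongrightarrow> ?P (t - \<tau> k ?p) (Z (\<tau> k ?p) ?p - x)" for k
          proof -
            have less: "\<tau> k ?p < t" using \<tau>_le[OF p, of k] True by simp
            have Zp: "(\<lambda>s. x + Y s \<omega>) = (\<lambda>s. Z s ?p)" by (simp add: Z_def)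
            show ?thesis
              unfolding S_def Zp
            proof (rule tendsto_grid_stop[OF Zc[OF p] open_collar t])
              show "hit_before t (collar D k) (\<lambda>s. Z s ?p) < t"
                using less by (simp add: \<tau>_def collar_hit_def)
              fix r z
              assume "r \<longlonglongrightarrow> t - hit_before t (collar D k) (\<lambda>s. Z s ?p)"
                and "z \<longlonglongrightarrow> Z (hit_before t (collar D k) (\<lambda>s. Z s ?p)) ?p"
              then show "(\<lambda>n. ?P (r n) (z n - x)) \<longlonglongrightarrow> ?P (t - \<tau> k ?p) (Z (\<tau> k ?p) ?p - x)"
                using less by (intro tendsto_rel_kernel tendsto_diff tendsto_const) (auto simp: \<tau>_def collar_hit_def)
            qed
          qed
          then have "liminf (\<lambda>n. ennreal (S k n \<omega>)) = ennreal (?P (t - \<tau> k ?p) (Z (\<tau> k ?p) ?p - x))" for k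
            by (intro lim_imp_Liminf tendsto_ennrealI) auto
          moreover have "(\<lambda>k. ?P (t - \<tau> k ?p) (Z (\<tau> k ?p) ?p - x)) \<longlonglongrightarrow> F ?p"
            using True unfolding F_def
            by (simp, intro tendsto_rel_kernel tendsto_diff tendsto_const lim \<tau>_lim[OF p]) auto
          then have "liminf (\<lambda>k. ennreal (?P (t - \<tau> k ?p) (Z (\<tau> k ?p) ?p - x))) = ennreal (F ?p)"
            by (intro lim_imp_Liminf tendsto_ennrealI) auto
          ultimately show ?thesis by simp
        qed (simp add: F_def)
      qed
    qed
    also have "\<dots> \<le> liminf (\<lambda>k. \<integral>\<^sup>+\<omega>. liminf (\<lambda>n. ennreal (S k n \<omega>)) \<partial>M)"
      by (intro nn_integral_liminf) measurable
    also have "\<dots> \<le> liminf (\<lambda>k. ennreal (?P t 0))"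
    proof (intro Liminf_mono always_eventually allI)
      fix k
      have "(\<integral>\<^sup>+\<omega>. liminf (\<lambda>n. ennreal (S k n \<omega>)) \<partial>M) \<le> liminf (\<lambda>n. \<integral>\<^sup>+\<omega>. ennreal (S k n \<omega>) \<partial>M)"
        by (intro nn_integral_liminf) measurable
      also have "\<dots> \<le> liminf (\<lambda>n. ennreal (?P t 0))"
        by (intro Liminf_mono always_eventually allI S_le)
      finally show "(\<integral>\<^sup>+\<omega>. liminf (\<lambda>n. ennreal (S k n \<omega>)) \<partial>M) \<le> ennreal (?P t 0)"
        by (simp add: Liminf_const)
    qed
    finally have "(\<integral>\<^sup>+\<omega>. ennreal (F (x, \<omega>)) \<partial>M) \<le> ennreal (?P t 0)"
      by (simp add: Liminf_const)
    then show ?thesis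
      unfolding R_def using Fx F_nonneg rel_kernel_nonneg[OF t]
      by (subst integral_eq_nn_integral) (auto intro!: enn2real_leI)
  qed
  show thesis
    by (rule that[OF Rm]) (use good in \<open>eventually_elim, simp add: eq le\<close>)
qed

lemma killed_correction_nonneg:
  assumes "0 < t" shows "0 \<le> killed_correction M X \<alpha> m \<theta> D t x y"
proof -
  have "0 < t - real_of_ereal e" if "e < ereal t" "0 \<le> e" for e
    using that by (cases e) auto
  moreover have "0 \<le> exit_time D f" for f
    unfolding exit_time_def by (intro Inf_greatest) auto
  ultimately show ?thesis
    unfolding killed_correction_def Let_def set_lebesgue_integral_def
    by (intro integral_nonneg_AE AE_I2) (auto simp: indicator_def intro!: rel_kernel_nonneg)
qed

text \<open>The path leaves \<open>D\<close> at a point outside the ball, and there the kernel is bounded uniformly in the remaining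
time. If the integrand is not integrable, the correction is 0 by convention and the bound is trivial.\<close>

lemma killed_correction_le_inside:
  assumes t: "0 < t" and D: "open D" and r: "0 < r" "ball x r \<subseteq> D"
  shows "killed_correction M X \<alpha> m \<theta> D t x x \<le> (real DIM('a) / (2 * pi * r\<^sup>2)) powr (real DIM('a) / 2)"
    (is "_ \<le> ?K")
proof -
  let ?\<tau> = "\<lambda>\<omega>. exit_time D (\<lambda>s. x + X s \<omega>)"
  let ?I = "\<lambda>\<omega>. indicator {\<omega> \<in> space M. ?\<tau> \<omega> < ereal t} \<omega> *\<^sub>R
      rel_kernel \<alpha> m \<theta> (t - real_of_ereal (?\<tau> \<omega>)) (x + X (real_of_ereal (?\<tau> \<omega>)) \<omega> - x)"
  have "AE \<omega> in M. ?I \<omega> \<le> ?K"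
    using cadlag_paths
  proof eventually_elim
    case (elim \<omega>)
    show ?case
    proof (cases "?\<tau> \<omega> < ereal t")
      case True
      define f where "f = (\<lambda>s. x + X s \<omega>)"
      define s where "s = hit_before t (- D) f"
      have f: "cadlag f" using elim unfolding f_def by (rule cadlag_translate)
      have \<tau>: "real_of_ereal (?\<tau> \<omega>) = s"
        using exit_time_eq_hit_before[OF True t] by (simp add: s_def f_def)
      have s: "0 \<le> s" using hit_before_bounds(1)[OF t] by (simp add: s_def)
      have less: "s < t"
        using True hit_before_less_iff[OF t order_refl, of "- D" f] by (simp add: exit_time_less_iff s_def f_def)
      have "f s \<notin> D"
      proof
        assume "f s \<in> D"
        then obtain \<eta> where \<eta>: "0 < \<eta>" "\<And>r. s \<le> r \<Longrightarrow> r < s + \<eta> \<Longrightarrow> f r \<in> D"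
          using cadlag_stays_in_open[OF f s D] by blast
        have "s < min t (s + \<eta>)" using less \<eta> by simp
        then obtain q where q: "0 \<le> q" "q < min t (s + \<eta>)" "f q \<in> - D"
          using hit_before_less_iff[OF t, of "min t (s + \<eta>)" "- D" f] by (auto simp: s_def)
        have "s \<le> q" unfolding s_def using t q(1,3) by (rule hit_before_le)
        then show False using \<eta>(2)[of q] q by auto
      qed
      then have "r \<le> norm (x + X s \<omega> - x)"
        using r(2) by (force simp: f_def dist_norm)
      from rel_kernel_away_from_origin[OF _ r(1) this, of "t - s"] less
      show ?thesis by (simp add: \<tau> indicator_def)
    qed simp
  qed
  then have AE: "AE \<omega> in completion M. ?I \<omega> \<le> ?K" by (rule AE_completion)
  interpret completed: prob_space "completion M" by (rule prob_space_completion)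
  have "(LINT \<omega>|completion M. ?I \<omega>) \<le> ?K"
  proof (cases "integrable (completion M) ?I")
    case True
    then show ?thesis using AE by (rule completed.integral_le_const)
  next
    case False
    then show ?thesis by (simp add: not_integrable_integral_eq)
  qed
  then show ?thesis
    by (simp add: killed_correction_def Let_def set_lebesgue_integral_def)
qed

end

section \<open>The heat trace\<close>

context relativistic_stable_density_process
begin

text \<open>The almost everywhere defined measurable representative of the correction is turned into integrability of the
correction itself by completeness of Lebesgue measure.\<close>

lemma heat_trace_split:
  fixes D :: "'a set"
  assumes t: "0 < t" and D: "open D" "emeasure lborel D < \<infinity>"
  defines "r \<equiv> \<lambda>x. killed_correction M X \<alpha> m \<theta> D t x x"
  shows "integrable lebesgue (\<lambda>x. indicator D x * r x)"
    and "AE x in lebesgue. r x \<le> rel_kernel \<alpha> m \<theta> t (0::'a)"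
    and "heat_trace M X \<alpha> m \<theta> D t = rel_kernel \<alpha> m \<theta> t (0::'a) * measure lebesgue D - (LINT x|lebesgue. indicator D x * r x)"
proof -
  let ?p = "rel_kernel \<alpha> m \<theta> t (0::'a)"
  have Db[measurable]: "D \<in> sets borel" using D by simp
  obtain R :: "'a \<Rightarrow> real" where R[measurable]: "R \<in> borel_measurable borel"
    and AE_R: "AE x in lborel. r x = R x \<and> R x \<le> ?p"
    using killed_correction_diagonal[OF t D] unfolding r_def by blast
  have AE: "AE x in lebesgue. r x = R x \<and> R x \<le> ?p" using AE_R by (rule AE_completion)
  then show le: "AE x in lebesgue. r x \<le> ?p" by eventually_elim simp
  have int_D: "integrable lebesgue (\<lambda>x. indicator D x * ?p)"
    using D by (intro integrable_mult_left integrable_real_indicator) auto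
  show int_r: "integrable lebesgue (\<lambda>x. indicator D x * r x)"
  proof (rule Bochner_Integration.integrable_bound[OF int_D])
    have "AE x in lebesgue. indicator D x * r x = indicator D x * R x"
      using AE by eventually_elim simp
    then show "(\<lambda>x. indicator D x * r x) \<in> borel_measurable lebesgue"
      by (rule borel_measurable_completion_cong_AE[rotated]) measurable
    show "AE x in lebesgue. norm (indicator D x * r x) \<le> norm (indicator D x * ?p)"
      using le
    proof eventually_elim
      case (elim x)
      moreover have "0 \<le> r x" unfolding r_def by (rule killed_correction_nonneg[OF t])
      ultimately show ?case by (auto simp: indicator_def)
    qed
  qed
  have "heat_trace M X \<alpha> m \<theta> D t = (LINT x|lebesgue. indicator D x * ?p - indicator D x * r x)"
    by (simp add: heat_trace_def set_lebesgue_integral_def killed_kernel_def r_def right_diff_distrib)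
  also have "\<dots> = (LINT x|lebesgue. indicator D x * ?p) - (LINT x|lebesgue. indicator D x * r x)"
    by (rule Bochner_Integration.integral_diff[OF int_D int_r])
  also have "(LINT x|lebesgue. indicator D x * ?p) = ?p * measure lebesgue D"
    by (simp add: mult.commute)
  finally show "heat_trace M X \<alpha> m \<theta> D t = ?p * measure lebesgue D - (LINT x|lebesgue. indicator D x * r x)" .
qed

text \<open>Dominated convergence along sequences of times. On \<open>D\<close>, which has finite measure, the scaled correction is
bounded by the scaled value of the kernel at the origin and hence by the constant \<open>C1\<close>.\<close>

lemma heat_trace_asymptotics:
  fixes D :: "'a set"
  assumes D: "open D" "emeasure lborel D < \<infinity>"
  shows "((\<lambda>t. t powr (real DIM('a) / \<alpha>) * exp (- m * t) * heat_trace M X \<alpha> m \<theta> D t)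
           \<longlongrightarrow> C1 DIM('a) \<alpha> * measure lebesgue D) (at_right 0)"
  unfolding tendsto_at_iff_sequentially comp_def
proof (intro allI impI)
  fix T :: "nat \<Rightarrow> real"
  assume "\<forall>i. T i \<in> {0<..} - {0}" and T0: "T \<longlonglongrightarrow> 0"
  then have T: "0 < T i" for i by auto
  let ?A = "C1 DIM('a) \<alpha>"
  define w where "w = (\<lambda>i. T i powr (real DIM('a) / \<alpha>) * exp (- m * T i))"
  have w_nonneg: "0 \<le> w i" for i by (simp add: w_def)
  have "(\<lambda>i. T i powr (real DIM('a) / \<alpha>)) \<longlonglongrightarrow> 0"
    using T alpha by (intro tendsto_zero_powrI[OF T0 tendsto_const]) (auto simp: less_imp_le[OF T])
  moreover have "(\<lambda>i. exp (- m * T i)) \<longlonglongrightarrow> exp (- m * 0)" by (intro tendsto_intros T0)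
  ultimately have w0: "w \<longlonglongrightarrow> 0"
    unfolding w_def using tendsto_mult by fastforce
  define p where "p = (\<lambda>i. rel_kernel \<alpha> m \<theta> (T i) (0::'a))"
  have p_le: "w i * p i \<le> ?A" for i
    unfolding w_def p_def by (rule rel_kernel_origin(2)[OF T])
  have p_ge: "?A * exp (- m * T i) \<le> w i * p i" for i
    unfolding w_def p_def by (rule rel_kernel_origin(3)[OF T])
  have "(\<lambda>i. ?A * exp (- m * T i)) \<longlonglongrightarrow> ?A * exp (- m * 0)" by (intro tendsto_intros T0)
  then have "(\<lambda>i. ?A * exp (- m * T i)) \<longlonglongrightarrow> ?A" by simp
  then have p_lim: "(\<lambda>i. w i * p i) \<longlonglongrightarrow> ?A"
    by (rule tendsto_sandwich[OF always_eventually always_eventually _ tendsto_const, rotated 2])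
       (intro allI p_ge p_le)+
  define r where "r = (\<lambda>i x. killed_correction M X \<alpha> m \<theta> D (T i) x x)"
  have int_r: "integrable lebesgue (\<lambda>x. indicator D x * r i x)" for i
    unfolding r_def by (rule heat_trace_split(1)[OF T D])
  have r_le: "AE x in lebesgue. r i x \<le> p i" for i
    unfolding r_def p_def by (rule heat_trace_split(2)[OF T D])
  have trace: "heat_trace M X \<alpha> m \<theta> D (T i) = p i * measure lebesgue D - (LINT x|lebesgue. indicator D x * r i x)" for i
    unfolding r_def p_def by (rule heat_trace_split(3)[OF T D])
  have r_nonneg: "0 \<le> r i x" for i x unfolding r_def by (rule killed_correction_nonneg[OF T])
  have "(\<lambda>i. LINT x|lebesgue. w i * (indicator D x * r i x)) \<longlonglongrightarrow> (LINT x|(lebesgue :: 'a measure). (0::real))"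
  proof (rule integral_dominated_convergence)
    show "integrable lebesgue (\<lambda>x. indicator D x * ?A)"
      using D by (intro integrable_mult_left integrable_real_indicator) auto
    show "(\<lambda>x. w i * (indicator D x * r i x)) \<in> borel_measurable lebesgue" for i
      by (rule borel_measurable_times[OF borel_measurable_const borel_measurable_integrable[OF int_r]])
    show "AE x in lebesgue. norm (w i * (indicator D x * r i x)) \<le> indicator D x * ?A" for i
      using r_le[of i]
    proof eventually_elim
      case (elim x)
      then have "w i * r i x \<le> ?A"
        using mult_left_mono[OF _ w_nonneg[of i], of "r i x" "p i"] p_le[of i] by simp
      then show ?case using w_nonneg[of i] r_nonneg[of i x] by (auto simp: indicator_def abs_mult)
    qed
    show "AE x in lebesgue. (\<lambda>i. w i * (indicator D x * r i x)) \<longlonglongrightarrow> 0"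
    proof (rule AE_I2)
      fix x
      show "(\<lambda>i. w i * (indicator D x * r i x)) \<longlonglongrightarrow> 0"
      proof (cases "x \<in> D")
        case True
        then obtain e where e: "0 < e" "ball x e \<subseteq> D" using D(1) by (auto simp: open_contains_ball)
        let ?K = "(real DIM('a) / (2 * pi * e\<^sup>2)) powr (real DIM('a) / 2)"
        have "(\<lambda>i. w i * ?K) \<longlonglongrightarrow> 0 * ?K" by (intro tendsto_intros w0)
        then have "(\<lambda>i. w i * ?K) \<longlonglongrightarrow> 0" by simp
        then have "(\<lambda>i. w i * r i x) \<longlonglongrightarrow> 0"
        proof (rule tendsto_sandwich[OF always_eventually always_eventually tendsto_const, rotated 2]; intro allI)
          show "0 \<le> w i * r i x" for i by (intro mult_nonneg_nonneg w_nonneg r_nonneg)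
          show "w i * r i x \<le> w i * ?K" for i
            unfolding r_def by (intro mult_left_mono w_nonneg killed_correction_le_inside[OF T D(1) e])
        qed
        then show ?thesis using True by simp
      qed simp
    qed
  qed simp
  then have "(\<lambda>i. w i * (LINT x|lebesgue. indicator D x * r i x)) \<longlonglongrightarrow> 0" by simp
  with tendsto_mult_right[OF p_lim, of "measure lebesgue D"]
  have "(\<lambda>i. w i * p i * measure lebesgue D - w i * (LINT x|lebesgue. indicator D x * r i x)) \<longlonglongrightarrow> ?A * measure lebesgue D - 0"
    by (rule tendsto_diff)
  then show "(\<lambda>i. T i powr (real DIM('a) / \<alpha>) * exp (- m * T i) * heat_trace M X \<alpha> m \<theta> D (T i)) \<longlonglongrightarrow> ?A * measure lebesgue D"
    unfolding trace by (simp add: w_def right_diff_distrib mult.assoc)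
qed

end

text \<open>A nondecreasing process started at 0 is nonnegative, and the existence of a density excludes the value 0.\<close>

lemma stable_subordinator_density:
  assumes alpha: "0 < \<alpha>" "\<alpha> < 2" and m: "0 < m"
    and sub: "stable_subordinator N T (\<alpha> / 2)"
    and nonneg: "\<And>t u. 0 < t \<Longrightarrow> 0 \<le> \<theta> t u"
    and dens: "\<And>t. 0 < t \<Longrightarrow> distributed N lborel (T t) (\<lambda>u. ennreal (\<theta> t u))"
  shows "stable_density \<alpha> m \<theta>"
proof
  interpret stable_subordinator N T "\<alpha> / 2" by (rule sub)
  show \<theta>m: "\<theta> t \<in> borel_measurable borel" if "0 < t" for t
    using distributed_real_measurable[OF nonneg[OF that] dens[OF that]] by simp
  fix t l :: real assume t: "0 < t" and l: "0 < l"
  note [measurable] = \<theta>m[OF t]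
  have [measurable]: "T t \<in> borel_measurable N" using t by (intro random_variable_X) simp
  have "AE \<omega> in N. T t \<omega> \<noteq> 0"
    using distributed_AE2[OF dens[OF t], of "\<lambda>u. u \<noteq> 0"] AE_lborel_singleton[of "0::real"] by (auto elim: eventually_mono)
  moreover have "AE \<omega> in N. 0 \<le> T t \<omega>"
    using nondecreasing_paths start_at_zero
  proof eventually_elim
    case (elim \<omega>)
    then show ?case using mono_onD[OF elim(1), of 0 t] t by simp
  qed
  ultimately have pos: "AE \<omega> in N. 0 < T t \<omega>" by eventually_elim simp
  have "(\<integral>\<^sup>+u\<in>{0<..}. ennreal (exp (- l * u) * \<theta> t u) \<partial>lborel)
      = (\<integral>\<^sup>+u. ennreal (\<theta> t u) * (ennreal (exp (- l * u)) * indicator {0<..} u) \<partial>lborel)"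
    using nonneg[OF t] by (intro nn_integral_cong) (auto simp: ennreal_mult mult_ac)
  also have "\<dots> = (\<integral>\<^sup>+\<omega>. ennreal (exp (- l * T t \<omega>)) * indicator {0<..} (T t \<omega>) \<partial>N)"
    by (rule distributed_nn_integral[OF dens[OF t]]) measurable
  also have "\<dots> = (\<integral>\<^sup>+\<omega>. ennreal (exp (- l * T t \<omega>)) \<partial>N)"
    using pos by (intro nn_integral_cong_AE) (auto elim: eventually_mono)
  also have "\<dots> = ennreal (expectation (\<lambda>\<omega>. exp (- l * T t \<omega>)))"
  proof (rule nn_integral_eq_integral)
    show "integrable N (\<lambda>\<omega>. exp (- l * T t \<omega>))"
      by (rule integrable_const_bound[where B = 1]) (use pos l in \<open>auto elim!: eventually_mono\<close>)
  qed simp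
  also have "expectation (\<lambda>\<omega>. exp (- l * T t \<omega>)) = exp (- t * l powr (\<alpha> / 2))"
    using t l by (intro laplace_transform) auto
  finally show "(\<integral>\<^sup>+u\<in>{0<..}. ennreal (exp (- l * u) * \<theta> t u) \<partial>lborel) = ennreal (exp (- t * l powr (\<alpha> / 2)))" .
qed (use alpha m nonneg in auto)

theorem proposition1p1:
  fixes M :: "'w measure" and X :: "real \<Rightarrow> 'w \<Rightarrow> 'a::euclidean_space"
    and N :: "'v measure" and T :: "real \<Rightarrow> 'v \<Rightarrow> real"
    and \<theta> :: "real \<Rightarrow> real \<Rightarrow> real"
    and \<alpha> m :: real and D :: "'a set"
  assumes "2 \<le> DIM('a)"
    and "0 < \<alpha>" and "\<alpha> < 2" and "0 < m"
    and "relativistic_stable_process M X \<alpha> m"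
    and "stable_subordinator N T (\<alpha> / 2)"
    and "\<And>t u. 0 < t \<Longrightarrow> 0 \<le> \<theta> t u"
    and "\<And>t. 0 < t \<Longrightarrow> distributed N lborel (T t) (\<lambda>u. ennreal (\<theta> t u))"
    and "open D" and "connected D" and "D \<noteq> {}"
    and "emeasure lebesgue D < \<infinity>"
  shows "((\<lambda>t. t powr (real DIM('a) / \<alpha>) * exp (- m * t) * heat_trace M X \<alpha> m \<theta> D t)
           \<longlongrightarrow> C1 DIM('a) \<alpha> * measure lebesgue D) (at_right 0)"
proof -
  interpret relativistic_stable_process M X \<alpha> m by fact
  interpret stable_density \<alpha> m \<theta>
    using assms(2-4,6-8) by (rule stable_subordinator_density)
  interpret relativistic_stable_density_process M X \<alpha> m \<theta> ..
  show ?thesis using assms(9,12) by (intro heat_trace_asymptotics) auto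
qed

end
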